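(* Suppose that the families $(\underline{A}_h^n)_{0\le n\le N}$, $(\underline{E}_h^n)_{0\le n\le N}$, $(\underline{\lambda}_h^n)_{0\le n\le N}$, with $(\underline{A}_h^n,\underline{E}_h^n,\underline{\lambda}_h^n)\in(X_{\mathrm{curl},h}\otimes\mathfrak g)\times(X_{\mathrm{curl},h}\otimes\mathfrak g)\times(X_{\mathrm{grad},h}\otimes\mathfrak g)$, solve the following constrained scheme with $\theta=1$ (implicit Euler time-stepping): for all $n\in\{0,\dots,N-1\}$, $$\delta_t^{n+1}\underline{A}_h=-\underline{E}_h^{n+\theta},$$ $$(\delta_t^{n+1}\underline{E}_h,\underline{v}_h)_{\mathrm{curl},\mathfrak g,h}+(G_h^{\mathfrak g}\underline{\lambda}_h^{n+1},\underline{v}_h)_{\mathrm{curl},\mathfrak g,h}+\int_U\langle[P^{\mathfrak g}_{\mathrm{curl},h}\underline{A}_h^{n+\theta},P^{\mathfrak g}_{\mathrm{grad},h}\underline{\lambda}_h^{n+1}],P^{\mathfrak g}_{\mathrm{curl},h}\underline{v}_h\rangle=(\underline{B}_h^{n+\theta},C_h^{\mathfrak g}\underline{v}_h+\star[\underline{A}_h^{n+\frac12},\underline{v}_h]^{\mathrm{div},h})_{\mathrm{div},\mathfrak g,h}\quad\forall\underline{v}_h\in X_{\mathrm{curl},h}\otimes\mathfrak g,$$ $$(\delta_t^{n+1}\underline{E}_h,G_h^{\mathfrak g}\underline{q}_h)_{\mathrm{curl},\mathfrak g,h}+\int_U\langle P^{\mathfrak g}_{\mathrm{curl},h}(\delta_t^{n+1}\underline{E}_h),[P^{\mathfrak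 g}_{\mathrm{curl},h}\underline{A}_h^{n+1-\theta},P^{\mathfrak g}_{\mathrm{grad},h}\underline{q}_h]\rangle=0\quad\forall\underline{q}_h\in X_{\mathrm{grad},h}\otimes\mathfrak g,$$ where $\underline{B}_h^n=C_h^{\mathfrak g}\underline{A}_h^n+\tfrac12\star[\underline{A}_h^n,\underline{A}_h^n]^{\mathrm{div},h}$. Suppose moreover that the initial conditions $(\underline{A}_h^0,\underline{E}_h^0)$ are such that, for all $\underline{q}_h\in X_{\mathrm{grad},h}\otimes\mathfrak g$, $$\mathfrak C^0(\underline{q}_h):=(\underline{E}_h^0,G_h^{\mathfrak g}\underline{q}_h)_{\mathrm{curl},\mathfrak g,h}+\int_U\langle P^{\mathfrak g}_{\mathrm{curl},h}\underline{E}_h^0,[P^{\mathfrak g}_{\mathrm{curl},h}\underline{A}_h^0,P^{\mathfrak g}_{\mathrm{grad},h}\underline{q}_h]\rangle=0.$$ Then, for all $n\in\{0,\dots,N-1\}$, $$\tfrac12\|\underline{E}_h^{n+1}\|_{\mathrm{curl},\mathfrak g,h}^2+\tfrac12\|\underline{B}_h^{n+1}\|_{\mathrm{div},\mathfrak g,h}^2\le\tfrac12\|\underline{E}_h^{n}\|_{\mathrm{curl},\mathfrak g,h}^2+\tfrac12\|\underline{B}_h^{n}\|_{\mathrm{div},\mathfrak g,h}^2.$$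
   Context: **Lie algebra.** $\mathfrak g$ is the (finite-dimensional, real) Lie algebra of a compact Lie group, with bracket $[\cdot,\cdot]$ and an inner product $\langle\cdot,\cdot\rangle$ that is Ad-invariant, so that $\langle[a,b],c\rangle=\langle a,[b,c]\rangle$ for all $a,b,c\in\mathfrak g$. $(e_I)_I$ is a basis of $\mathfrak g$; repeated indices are summed. For $\mathfrak g$-valued vector fields $v,w$ and a $\mathfrak g$-valued function $q$ on (a subset of) $\mathbb R^3$: $[v,q]^\alpha=[v^\alpha,q]$; $(\star[v,w])^\alpha=\varepsilon_{\alpha\mu\nu}[v^\mu,w^\nu]$ with $\varepsilon$ the Levi-Civita symbol; $\langle v,w\rangle=\sum_\mu\langle v^\mu,w^\mu\rangle$. **Mesh.** $U\subset\mathbb R^3$ is a connected bounded polyhedral domain, partitioned by a finite conforming polyhedral mesh with sets of elements $\mathcal T_h$ (polyhedra), flat polygonal faces $\mathcal F_h$, straight edges $\mathcal E_h$ and vertices $\mathcal V_h$ (elements and faces are contractible with Lipschitz boundary). $\mathcal F_T,\mathcal E_T$ are the faces and edges of $T$, $\mathcal E_F$ the edges of $F$; $|\cdot|$ is the measure and $h_P$ the diameter of $P$. Each face $F$ has a fixed unit normal $n_F$, each edge $E$ a fixed unit tangent $t_E$. $\omega_{TF}=+1$ if $n_F$ points out of $T$, $-1$ otherwise. For $E\in\mathcal E_F$, $n_{FE}$ is the unit normal to $E$ in the plane of $F$ with $(t_E,n_{FE},n_F)$ right-handed, and $\omega_{FE}\in\{\pm1\}$ is such that $\omega_{FE}n_{FE}$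 points out of $F$. $H_F$ is the vector plane tangent to $F$; $\nabla_F,\mathrm{div}_F$ are the tangential gradient and divergence; $\mathbf{rot}_F r=(\nabla_F r)^\perp$ with $\perp$ the rotation by $-\pi/2$ in $H_F$ oriented by $n_F$. For $P\in\mathcal T_h\cup\mathcal F_h\cup\mathcal E_h$, $\mathcal P^k(P)$ denotes polynomials of degree $\le k$ on $P$, $\mathcal P^{0,1}(P)=\{r\in\mathcal P^1(P):\int_P r=0\}$, and $x_P$ is a fixed point of $P$. For $\xi\in\mathbb R^3$, $\xi_{\mathrm t,F}=n_F\times(\xi\times n_F)$. **Scalar discrete spaces and operators.** $X_{\mathrm{grad},h}$ is the space of continuous functions $q$ on the union of the edges with $q_E:=q|_E\in\mathcal P^1(E)$ for each edge; $X_{\mathrm{curl},h}=\{(v_E)_{E\in\mathcal E_h}:v_E\in\mathbb R\}$; $X_{\mathrm{div},h}=\{(w_F)_{F\in\mathcal F_h}:w_F\in\mathbb R\}$. An index $T$ or $F$ in place of $h$ denotes restriction to the edges/faces of $T$ or $F$. Define $G_h\underline q_h=(q_E')_{E}$ (derivative along $t_E$); $C_h\underline v_h=(C_F\underline v_F)_F$ with $C_F\underline v_F=-\frac1{|F|}\sum_{E\in\mathcal E_F}\omega_{FE}|E|v_E$; $D_T\underline w_T=\frac1{|T|}\sum_{F\in\mathcal F_T}\omega_{TF}|F|w_F$. **Potentials.** - For $\underline q_F$: $\mathsf G_F\underline q_F\in H_F$ with $\mathsf G_F\underline q_F\cdot\xi=\frac1{|F|}\sum_{E\in\mathcal E_F}\omega_{FE}\int_E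 q_E\,\xi\cdot n_{FE}$ for all $\xi\in H_F$; $\gamma_F\underline q_F\in\mathcal P^1(F)$ with $\int_F\gamma_F\underline q_F\,\mathrm{div}_F v=-\int_F\mathsf G_F\underline q_F\cdot v+\sum_{E\in\mathcal E_F}\omega_{FE}\int_E q_E\,v\cdot n_{FE}$ for all $v\in(x-x_F)\mathcal P^1(F)$. - For $\underline q_T$: $\mathsf G_T\underline q_T\in\mathbb R^3$ with $\mathsf G_T\underline q_T\cdot\xi=\frac1{|T|}\sum_{F\in\mathcal F_T}\omega_{TF}\int_F\gamma_F\underline q_F\,\xi\cdot n_F$ for all $\xi\in\mathbb R^3$; $P_{\mathrm{grad},T}\underline q_T\in\mathcal P^1(T)$ with $\int_T P_{\mathrm{grad},T}\underline q_T\,\mathrm{div}\,v=-\int_T\mathsf G_T\underline q_T\cdot v+\sum_{F\in\mathcal F_T}\omega_{TF}\int_F\gamma_F\underline q_F\,v\cdot n_F$ for all $v\in(x-x_T)\mathcal P^1(T)$. - $\gamma_{\mathrm t,F}\underline v_F\in H_F$ with $\gamma_{\mathrm t,F}\underline v_F\cdot\mathbf{rot}_F r=\frac1{|F|}\int_F C_F\underline v_F\,r+\frac1{|F|}\sum_{E\in\mathcal E_F}\omega_{FE}\int_E v_E r$ for all $r\in\mathcal P^{0,1}(F)$. - $\mathsf C_T\underline v_T\in\mathbb R^3$ with $\mathsf C_T\underline v_T\cdot\xi=\frac1{|T|}\sum_{F\in\mathcal F_T}\omega_{TF}|F|\,\gamma_{\mathrm t,F}\underline v_F\cdot(\xi\times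 n_F)$ for all $\xi\in\mathbb R^3$; $P_{\mathrm{curl},T}\underline v_T\in\mathbb R^3$ with $P_{\mathrm{curl},T}\underline v_T\cdot\mathrm{curl}\,w=\frac1{|T|}\int_T\mathsf C_T\underline v_T\cdot w-\frac1{|T|}\sum_{F\in\mathcal F_T}\omega_{TF}\int_F\gamma_{\mathrm t,F}\underline v_F\cdot(w\times n_F)$ for all $w\in(x-x_T)\times\mathbb R^3$. - $P_{\mathrm{div},T}\underline w_T\in\mathbb R^3$ with $P_{\mathrm{div},T}\underline w_T\cdot\nabla r=-\frac1{|T|}\int_T D_T\underline w_T\,r+\frac1{|T|}\sum_{F\in\mathcal F_T}\omega_{TF}\int_F w_F r$ for all $r\in\mathcal P^{0,1}(T)$. **Inner products.** $(\underline\mu_h,\underline\zeta_h)_{\bullet,h}=\sum_{T}\big(\int_T P_{\bullet,T}\underline\mu_T\cdot P_{\bullet,T}\underline\zeta_T+s_{\bullet,T}(\underline\mu_T,\underline\zeta_T)\big)$ for $\bullet\in\{\mathrm{curl},\mathrm{div}\}$, where $s_{\mathrm{curl},T}(\underline v_T,\underline w_T)=\sum_{F\in\mathcal F_T}h_F\int_F((P_{\mathrm{curl},T}\underline v_T)_{\mathrm t,F}-\gamma_{\mathrm t,F}\underline v_F)\cdot((P_{\mathrm{curl},T}\underline w_T)_{\mathrm t,F}-\gamma_{\mathrm t,F}\underline w_F)+\sum_{E\in\mathcal E_T}h_E^2\int_E(P_{\mathrm{curl},T}\underline v_T\cdot t_E-v_E)(P_{\mathrm{curl},T}\underline w_T\cdot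 t_E-w_E)$ and $s_{\mathrm{div},T}(\underline v_T,\underline w_T)=\sum_{F\in\mathcal F_T}h_F\int_F(P_{\mathrm{div},T}\underline v_T\cdot n_F-v_F)(P_{\mathrm{div},T}\underline w_T\cdot n_F-w_F)$. **Lie algebra-valued versions.** $X_{\bullet,h}\otimes\mathfrak g$ is the same space with $\mathfrak g$-valued components. Any scalar linear operator $L$ extends by $L^{\mathfrak g}(v^I\otimes e_I)=(Lv^I)\otimes e_I$. The inner products are $(\underline\mu_h,\underline\zeta_h)_{\bullet,\mathfrak g,h}=(\underline\mu_h^I,\underline\zeta_h^J)_{\bullet,h}\langle e_I,e_J\rangle$, with induced norms $\|\cdot\|_{\bullet,\mathfrak g,h}$. $P^{\mathfrak g}_{\mathrm{grad},h}$ and $P^{\mathfrak g}_{\mathrm{curl},h}$ are the piecewise functions on $U$ equal to $P^{\mathfrak g}_{\mathrm{grad},T}$, $P^{\mathfrak g}_{\mathrm{curl},T}$ on each $T$. The discrete bracket $\star[\cdot,\cdot]^{\mathrm{div},h}:(X_{\mathrm{curl},h}\otimes\mathfrak g)^2\to X_{\mathrm{div},h}\otimes\mathfrak g$ is defined by $(\star[\underline v_h,\underline w_h]^{\mathrm{div},h})_F=\star[\gamma^{\mathfrak g}_{\mathrm t,F}\underline v_F,\gamma^{\mathfrak g}_{\mathrm t,F}\underline w_F]\cdot n_F$ for all $F\in\mathcal F_h$. **Time stepping.** $0=t^0<t^1<\dots<t^N$ is a (not necessarily uniform) partition of the time interval and $\delta t^{n+\frac12}=t^{n+1}-t^n$.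 For a family $(Z^n)_n$: $\delta_t^{n+1}Z=(Z^{n+1}-Z^n)/\delta t^{n+\frac12}$ and, for any $s\in[0,1]$, $Z^{n+s}=sZ^{n+1}+(1-s)Z^n$ (in particular $Z^{n+1-\theta}=(1-\theta)Z^{n+1}+\theta Z^n$ and $Z^{n+\frac12}=\frac12(Z^n+Z^{n+1})$; this applies also to $\underline B_h^{n+\theta}$). For $\theta=1$: $Z^{n+\theta}=Z^{n+1}$ and $Z^{n+1-\theta}=Z^n$. *)

theory Defs
  imports "HOL-Analysis.Analysis"
begin

type_synonym R3 = "real^3"

text \<open>
  Cells are relatively open: elements are open sets, faces are open in their plane, edges are
  open segments. The fields \<open>nrm\<close>, \<open>tgt\<close>, \<open>pnt\<close> hold the fixed unit normals of the faces, the
  fixed unit tangents of the edges and the fixed points \<open>x\<^sub>P\<close> of the cells.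
\<close>

record mesh =
  region :: "R3 set"
  elems :: "R3 set set"
  faces :: "R3 set set"
  edges :: "R3 set set"
  verts :: "R3 set"
  nrm :: "R3 set \<Rightarrow> R3"
  tgt :: "R3 set \<Rightarrow> R3"
  pnt :: "R3 set \<Rightarrow> R3"

text \<open>
  Polyhedra need not be convex, so they are finite unions of convex polytopes.
\<close>

definition polyhedral :: "'a::euclidean_space set \<Rightarrow> bool" where
  "polyhedral S \<longleftrightarrow> (\<exists>\<P>. finite \<P> \<and> (\<forall>P\<in>\<P>. polytope P) \<and> S = \<Union>\<P>)"

text \<open>
  Near each boundary point \<open>S\<close> is, within its affine hull, the set of points lying strictly above
  the graph of a Lipschitz function, the height being measured along a unit vector \<open>u\<close>.
\<close>

definition lipschitz_boundary :: "'a::euclidean_space set \<Rightarrow> bool" where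
  "lipschitz_boundary S \<longleftrightarrow>
     (\<forall>x\<in>rel_frontier S. \<exists>u r L \<phi>. norm u = 1 \<and> x + u \<in> affine hull S \<and> r > 0 \<and>
        L-lipschitz_on UNIV (\<phi> :: 'a \<Rightarrow> real) \<and>
        (\<forall>y \<in> affine hull S \<inter> ball x r.
           y \<in> S \<longleftrightarrow> \<phi> ((y - x) - ((y - x) \<bullet> u) *\<^sub>R u) < (y - x) \<bullet> u))"

definition polyhedral_cell :: "int \<Rightarrow> 'a::euclidean_space set \<Rightarrow> bool" where
  "polyhedral_cell k S \<longleftrightarrow>
     S \<noteq> {} \<and> aff_dim S = k \<and> openin (top_of_set (affine hull S)) S \<and>
     polyhedral (closure S) \<and> contractible S \<and> lipschitz_boundary S"

definition tangent_space :: "R3 set \<Rightarrow> R3 set" where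
  "tangent_space S = span {x - y | x y. x \<in> S \<and> y \<in> S}"

definition elem_faces :: "mesh \<Rightarrow> R3 set \<Rightarrow> R3 set set" where
  "elem_faces M T = {F \<in> faces M. F \<subseteq> frontier T}"

definition elem_edges :: "mesh \<Rightarrow> R3 set \<Rightarrow> R3 set set" where
  "elem_edges M T = {E \<in> edges M. E \<subseteq> frontier T}"

definition face_edges :: "mesh \<Rightarrow> R3 set \<Rightarrow> R3 set set" where
  "face_edges M F = {E \<in> edges M. E \<subseteq> rel_frontier F}"

text \<open>
  The condition \<open>interior (closure U) = U\<close> excludes slits in the domain. Conformity: the cells of
  all dimensions are pairwise disjoint, and the boundary of every cell is a union of closed cells
  of the next lower dimension.
\<close>

definition polyhedral_mesh :: "mesh \<Rightarrow> bool" where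
  "polyhedral_mesh M \<longleftrightarrow>
     open (region M) \<and> connected (region M) \<and> bounded (region M) \<and> region M \<noteq> {} \<and>
     polyhedral (closure (region M)) \<and> interior (closure (region M)) = region M \<and>
     finite (elems M) \<and> finite (faces M) \<and> finite (edges M) \<and> finite (verts M) \<and>
     (\<forall>T\<in>elems M. polyhedral_cell 3 T) \<and>
     (\<forall>F\<in>faces M. polyhedral_cell 2 F) \<and>
     (\<forall>E\<in>edges M. \<exists>a\<in>verts M. \<exists>b\<in>verts M. a \<noteq> b \<and> E = open_segment a b) \<and>
     pairwise disjnt (elems M \<union> faces M \<union> edges M \<union> (\<lambda>a. {a}) ` verts M) \<and>
     closure (region M) = (\<Union>T\<in>elems M. closure T) \<and>
     (\<forall>T\<in>elems M. frontier T = (\<Union>F\<in>elem_faces M T. closure F)) \<and>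
     (\<forall>F\<in>faces M. rel_frontier F = (\<Union>E\<in>face_edges M F. closure E)) \<and>
     (\<forall>F\<in>faces M. \<exists>T\<in>elems M. F \<in> elem_faces M T) \<and>
     (\<forall>E\<in>edges M. \<exists>F\<in>faces M. E \<in> face_edges M F) \<and>
     (\<forall>a\<in>verts M. \<exists>E\<in>edges M. a \<in> closure E) \<and>
     (\<forall>F\<in>faces M. norm (nrm M F) = 1 \<and> (\<forall>\<xi>\<in>tangent_space F. nrm M F \<bullet> \<xi> = 0)) \<and>
     (\<forall>E\<in>edges M. norm (tgt M E) = 1 \<and> tgt M E \<in> tangent_space E) \<and>
     (\<forall>P\<in>elems M \<union> faces M \<union> edges M. pnt M P \<in> closure P)"

text \<open>\<open>points_out S W n\<close>: at the points of the boundary piece \<open>W\<close>, moving along \<open>n\<close> leaves \<open>S\<close>.\<close>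

definition points_out :: "R3 set \<Rightarrow> R3 set \<Rightarrow> R3 \<Rightarrow> bool" where
  "points_out S W n \<longleftrightarrow> (\<forall>x\<in>W. \<forall>\<^sub>F s in at_right 0. x + s *\<^sub>R n \<notin> S)"

definition omega_TF :: "mesh \<Rightarrow> R3 set \<Rightarrow> R3 set \<Rightarrow> real" where
  "omega_TF M T F = (if points_out T F (nrm M F) then 1 else -1)"

text \<open>\<open>n\<^sub>F \<times> t\<^sub>E\<close> is the vector that makes \<open>(t\<^sub>E, n\<^sub>F\<^sub>E, n\<^sub>F)\<close> a right-handed orthonormal frame.\<close>

definition nrm_FE :: "mesh \<Rightarrow> R3 set \<Rightarrow> R3 set \<Rightarrow> R3" where
  "nrm_FE M F E = cross3 (nrm M F) (tgt M E)"

definition omega_FE :: "mesh \<Rightarrow> R3 set \<Rightarrow> R3 set \<Rightarrow> real" where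
  "omega_FE M F E = (if points_out F E (nrm_FE M F E) then 1 else -1)"

text \<open>
  Area on the plane through \<open>p\<close> with unit normal \<open>n\<close> (arc length on the line through \<open>p\<close> with unit
  direction \<open>t\<close>) is the image of Lebesgue measure under an isometric parametrisation. By rotation
  invariance it does not depend on the choice of the orthonormal frame \<open>(a, n \<times> a)\<close>.
\<close>

definition plane_measure :: "R3 \<Rightarrow> R3 \<Rightarrow> R3 measure" where
  "plane_measure p n =
     (let a = (SOME a. norm a = 1 \<and> a \<bullet> n = 0)
      in distr (lborel :: (real \<times> real) measure) borel
           (\<lambda>(s, t). p + s *\<^sub>R a + t *\<^sub>R cross3 n a))"

definition line_measure :: "R3 \<Rightarrow> R3 \<Rightarrow> R3 measure" where
  "line_measure p t = distr (lborel :: real measure) borel (\<lambda>s. p + s *\<^sub>R t)"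

definition face_measure :: "mesh \<Rightarrow> R3 set \<Rightarrow> R3 measure" where
  "face_measure M F = plane_measure (pnt M F) (nrm M F)"

definition edge_measure :: "mesh \<Rightarrow> R3 set \<Rightarrow> R3 measure" where
  "edge_measure M E = line_measure (pnt M E) (tgt M E)"

definition vol :: "R3 set \<Rightarrow> real" where
  "vol T = measure lborel T"

definition area :: "mesh \<Rightarrow> R3 set \<Rightarrow> real" where
  "area M F = measure (face_measure M F) F"

definition len :: "mesh \<Rightarrow> R3 set \<Rightarrow> real" where
  "len M E = measure (edge_measure M E) E"

definition int_vol :: "R3 set \<Rightarrow> (R3 \<Rightarrow> real) \<Rightarrow> real" where
  "int_vol T f = (LINT x:T|lborel. f x)"

definition int_face :: "mesh \<Rightarrow> R3 set \<Rightarrow> (R3 \<Rightarrow> real) \<Rightarrow> real" where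
  "int_face M F f = (LINT x:F|face_measure M F. f x)"

definition int_edge :: "mesh \<Rightarrow> R3 set \<Rightarrow> (R3 \<Rightarrow> real) \<Rightarrow> real" where
  "int_edge M E f = (LINT x:E|edge_measure M E. f x)"

text \<open>
  A polynomial of degree at most 1 on a cell \<open>P\<close> is identified with its unique affine extension to
  the whole space that is constant in the directions orthogonal to \<open>P\<close>; this makes its values on
  the boundary of \<open>P\<close> available.
\<close>

definition poly1 :: "R3 set \<Rightarrow> (R3 \<Rightarrow> real) set" where
  "poly1 P = {\<lambda>x. a \<bullet> x + b | a b. a \<in> tangent_space P}"

definition poly01_face :: "mesh \<Rightarrow> R3 set \<Rightarrow> (R3 \<Rightarrow> real) set" where
  "poly01_face M F = {r \<in> poly1 F. int_face M F r = 0}"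

definition poly01_elem :: "R3 set \<Rightarrow> (R3 \<Rightarrow> real) set" where
  "poly01_elem T = {r \<in> poly1 T. int_vol T r = 0}"

definition grad :: "(R3 \<Rightarrow> real) \<Rightarrow> R3 \<Rightarrow> R3" where
  "grad r x = (THE d. GDERIV r x :> d)"

text \<open>\<open>jac v x i j\<close> is the partial derivative of \<open>v\<^sub>i\<close> in the direction \<open>j\<close>.\<close>

definition jac :: "(R3 \<Rightarrow> R3) \<Rightarrow> R3 \<Rightarrow> 3 \<Rightarrow> 3 \<Rightarrow> real" where
  "jac v x i j = frechet_derivative v (at x) (axis j 1) $ i"

definition dvg :: "(R3 \<Rightarrow> R3) \<Rightarrow> R3 \<Rightarrow> real" where
  "dvg v x = (\<Sum>i\<in>UNIV. jac v x i i)"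

definition curl :: "(R3 \<Rightarrow> R3) \<Rightarrow> R3 \<Rightarrow> R3" where
  "curl w x = vector [jac w x 3 2 - jac w x 2 3,
                      jac w x 1 3 - jac w x 3 1,
                      jac w x 2 1 - jac w x 1 2]"

definition tang :: "R3 \<Rightarrow> R3 \<Rightarrow> R3" where
  "tang n \<xi> = cross3 n (cross3 \<xi> n)"

definition grad_F :: "R3 \<Rightarrow> (R3 \<Rightarrow> real) \<Rightarrow> R3 \<Rightarrow> R3" where
  "grad_F n r x = tang n (grad r x)"

definition div_F :: "R3 \<Rightarrow> (R3 \<Rightarrow> R3) \<Rightarrow> R3 \<Rightarrow> real" where
  "div_F n v x = dvg v x - frechet_derivative v (at x) n \<bullet> n"

text \<open>On the plane orthogonal to \<open>n\<close>, \<open>\<xi> \<mapsto> \<xi> \<times> n\<close> is the rotation by \<open>-\<pi>/2\<close> oriented by \<open>n\<close>.\<close>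

definition rot_F :: "R3 \<Rightarrow> (R3 \<Rightarrow> real) \<Rightarrow> R3 \<Rightarrow> R3" where
  "rot_F n r x = cross3 (grad_F n r x) n"

definition skeleton :: "mesh \<Rightarrow> R3 set" where
  "skeleton M = (\<Union>E\<in>edges M. closure E)"

text \<open>
  Functions on the skeleton and families indexed by edges are extended by zero to total functions.
\<close>

definition X_grad :: "mesh \<Rightarrow> (R3 \<Rightarrow> real) set" where
  "X_grad M = {q. continuous_on (skeleton M) q \<and>
                  (\<forall>E\<in>edges M. \<exists>r\<in>poly1 E. \<forall>x\<in>E. q x = r x) \<and>
                  (\<forall>x. x \<notin> skeleton M \<longrightarrow> q x = 0)}"

definition X_curl :: "mesh \<Rightarrow> (R3 set \<Rightarrow> real) set" where
  "X_curl M = {v. \<forall>E. E \<notin> edges M \<longrightarrow> v E = 0}"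

definition G_h :: "mesh \<Rightarrow> (R3 \<Rightarrow> real) \<Rightarrow> R3 set \<Rightarrow> real" where
  "G_h M q E =
     (if E \<in> edges M
      then THE d. \<forall>x\<in>E. ((\<lambda>s. q (x + s *\<^sub>R tgt M E)) has_real_derivative d) (at 0)
      else 0)"

definition C_h :: "mesh \<Rightarrow> (R3 set \<Rightarrow> real) \<Rightarrow> R3 set \<Rightarrow> real" where
  "C_h M v F = - (1 / area M F) * (\<Sum>E\<in>face_edges M F. omega_FE M F E * len M E * v E)"

definition D_T :: "mesh \<Rightarrow> R3 set \<Rightarrow> (R3 set \<Rightarrow> real) \<Rightarrow> real" where
  "D_T M T w = (1 / vol T) * (\<Sum>F\<in>elem_faces M T. omega_TF M T F * area M F * w F)"

text \<open>
  Arguments are global families; each operator reads only the components attached to its cell.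
  Differential operators applied to the test functions \<open>r\<close> and \<open>w\<close> below give constant fields,
  which are evaluated at the point of the cell.
\<close>

definition G_F :: "mesh \<Rightarrow> R3 set \<Rightarrow> (R3 \<Rightarrow> real) \<Rightarrow> R3" where
  "G_F M F q = (THE g. g \<in> tangent_space F \<and> (\<forall>\<xi>\<in>tangent_space F.
      g \<bullet> \<xi> = (1 / area M F) *
        (\<Sum>E\<in>face_edges M F. omega_FE M F E * int_edge M E (\<lambda>x. q x * (\<xi> \<bullet> nrm_FE M F E)))))"

definition gamma_F :: "mesh \<Rightarrow> R3 set \<Rightarrow> (R3 \<Rightarrow> real) \<Rightarrow> R3 \<Rightarrow> real" where
  "gamma_F M F q = (THE g. g \<in> poly1 F \<and>
     (\<forall>p\<in>poly1 F. let v = (\<lambda>x. p x *\<^sub>R (x - pnt M F)) in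
        int_face M F (\<lambda>x. g x * div_F (nrm M F) v x) =
          - int_face M F (\<lambda>x. G_F M F q \<bullet> v x) +
          (\<Sum>E\<in>face_edges M F. omega_FE M F E *
             int_edge M E (\<lambda>x. q x * (v x \<bullet> nrm_FE M F E)))))"

definition G_T :: "mesh \<Rightarrow> R3 set \<Rightarrow> (R3 \<Rightarrow> real) \<Rightarrow> R3" where
  "G_T M T q = (THE g. \<forall>\<xi>.
      g \<bullet> \<xi> = (1 / vol T) *
        (\<Sum>F\<in>elem_faces M T. omega_TF M T F *
           int_face M F (\<lambda>x. gamma_F M F q x * (\<xi> \<bullet> nrm M F))))"

definition P_grad :: "mesh \<Rightarrow> R3 set \<Rightarrow> (R3 \<Rightarrow> real) \<Rightarrow> R3 \<Rightarrow> real" where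
  "P_grad M T q = (THE g. g \<in> poly1 T \<and>
     (\<forall>p\<in>poly1 T. let v = (\<lambda>x. p x *\<^sub>R (x - pnt M T)) in
        int_vol T (\<lambda>x. g x * dvg v x) =
          - int_vol T (\<lambda>x. G_T M T q \<bullet> v x) +
          (\<Sum>F\<in>elem_faces M T. omega_TF M T F *
             int_face M F (\<lambda>x. gamma_F M F q x * (v x \<bullet> nrm M F)))))"

definition gamma_t :: "mesh \<Rightarrow> R3 set \<Rightarrow> (R3 set \<Rightarrow> real) \<Rightarrow> R3" where
  "gamma_t M F v = (THE g. g \<in> tangent_space F \<and> (\<forall>r\<in>poly01_face M F.
      g \<bullet> rot_F (nrm M F) r (pnt M F) =
        (1 / area M F) * int_face M F (\<lambda>x. C_h M v F * r x) +
        (1 / area M F) *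
          (\<Sum>E\<in>face_edges M F. omega_FE M F E * int_edge M E (\<lambda>x. v E * r x))))"

definition C_T :: "mesh \<Rightarrow> R3 set \<Rightarrow> (R3 set \<Rightarrow> real) \<Rightarrow> R3" where
  "C_T M T v = (THE g. \<forall>\<xi>.
      g \<bullet> \<xi> = (1 / vol T) *
        (\<Sum>F\<in>elem_faces M T. omega_TF M T F * area M F *
           (gamma_t M F v \<bullet> cross3 \<xi> (nrm M F))))"

definition P_curl :: "mesh \<Rightarrow> R3 set \<Rightarrow> (R3 set \<Rightarrow> real) \<Rightarrow> R3" where
  "P_curl M T v = (THE g. \<forall>\<xi>. let w = (\<lambda>x. cross3 (x - pnt M T) \<xi>) in
      g \<bullet> curl w (pnt M T) =
        (1 / vol T) * int_vol T (\<lambda>x. C_T M T v \<bullet> w x) -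
        (1 / vol T) *
          (\<Sum>F\<in>elem_faces M T. omega_TF M T F *
             int_face M F (\<lambda>x. gamma_t M F v \<bullet> cross3 (w x) (nrm M F))))"

definition P_div :: "mesh \<Rightarrow> R3 set \<Rightarrow> (R3 set \<Rightarrow> real) \<Rightarrow> R3" where
  "P_div M T w = (THE g. \<forall>r\<in>poly01_elem T.
      g \<bullet> grad r (pnt M T) =
        - (1 / vol T) * int_vol T (\<lambda>x. D_T M T w * r x) +
        (1 / vol T) *
          (\<Sum>F\<in>elem_faces M T. omega_TF M T F * int_face M F (\<lambda>x. w F * r x)))"

definition s_curl :: "mesh \<Rightarrow> R3 set \<Rightarrow> (R3 set \<Rightarrow> real) \<Rightarrow> (R3 set \<Rightarrow> real) \<Rightarrow> real" where
  "s_curl M T v w =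
     (\<Sum>F\<in>elem_faces M T. diameter F * int_face M F (\<lambda>x.
        (tang (nrm M F) (P_curl M T v) - gamma_t M F v) \<bullet>
        (tang (nrm M F) (P_curl M T w) - gamma_t M F w))) +
     (\<Sum>E\<in>elem_edges M T. (diameter E)\<^sup>2 * int_edge M E (\<lambda>x.
        (P_curl M T v \<bullet> tgt M E - v E) * (P_curl M T w \<bullet> tgt M E - w E)))"

definition s_div :: "mesh \<Rightarrow> R3 set \<Rightarrow> (R3 set \<Rightarrow> real) \<Rightarrow> (R3 set \<Rightarrow> real) \<Rightarrow> real" where
  "s_div M T v w =
     (\<Sum>F\<in>elem_faces M T. diameter F * int_face M F (\<lambda>x.
        (P_div M T v \<bullet> nrm M F - v F) * (P_div M T w \<bullet> nrm M F - w F)))"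

definition ip_curl :: "mesh \<Rightarrow> (R3 set \<Rightarrow> real) \<Rightarrow> (R3 set \<Rightarrow> real) \<Rightarrow> real" where
  "ip_curl M v w =
     (\<Sum>T\<in>elems M. int_vol T (\<lambda>x. P_curl M T v \<bullet> P_curl M T w) + s_curl M T v w)"

definition ip_div :: "mesh \<Rightarrow> (R3 set \<Rightarrow> real) \<Rightarrow> (R3 set \<Rightarrow> real) \<Rightarrow> real" where
  "ip_div M v w =
     (\<Sum>T\<in>elems M. int_vol T (\<lambda>x. P_div M T v \<bullet> P_div M T w) + s_div M T v w)"

text \<open>
  The Lie algebra is the whole type \<open>'g\<close>, its inner product is the one of the type class; class
  \<open>real_inner\<close> rather than \<open>euclidean_space\<close> keeps the zero algebra admissible. Finite dimension
  comes from the finite basis. Finite-dimensional real Lie algebras with an invariant inner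
  product are, up to isomorphism, exactly the Lie algebras of compact Lie groups.
\<close>

definition invariant_lie_bracket :: "('g::real_inner \<Rightarrow> 'g \<Rightarrow> 'g) \<Rightarrow> bool" where
  "invariant_lie_bracket br \<longleftrightarrow>
     bilinear br \<and> (\<forall>a. br a a = 0) \<and>
     (\<forall>a b c. br a (br b c) + br b (br c a) + br c (br a b) = 0) \<and>
     (\<forall>a b c. br a b \<bullet> c = a \<bullet> br b c)"

definition finite_basis :: "'g::real_vector set \<Rightarrow> bool" where
  "finite_basis B \<longleftrightarrow> finite B \<and> independent B \<and> span B = UNIV"

definition coord :: "'g::real_vector set \<Rightarrow> 'g \<Rightarrow> ('x \<Rightarrow> 'g) \<Rightarrow> 'x \<Rightarrow> real" where
  "coord B b v = (\<lambda>x. representation B (v x) b)"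

text \<open>
  The extensions of scalar linear operators with values in real-valued functions (\<open>ext\<close>) and in
  vectors (\<open>ext_vec\<close>). Vectors with components in the Lie algebra have type \<open>'g^3\<close>, whose library
  inner product is the sum of the inner products of the components.
\<close>

definition ext ::
    "'g::real_vector set \<Rightarrow> (('x \<Rightarrow> real) \<Rightarrow> 'y \<Rightarrow> real) \<Rightarrow> ('x \<Rightarrow> 'g) \<Rightarrow> 'y \<Rightarrow> 'g" where
  "ext B L v = (\<lambda>y. \<Sum>b\<in>B. L (coord B b v) y *\<^sub>R b)"

definition ext_vec ::
    "'g::real_vector set \<Rightarrow> (('x \<Rightarrow> real) \<Rightarrow> R3) \<Rightarrow> ('x \<Rightarrow> 'g) \<Rightarrow> 'g^3" where
  "ext_vec B L v = (\<chi> i. \<Sum>b\<in>B. (L (coord B b v) $ i) *\<^sub>R b)"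

definition ip_g ::
    "'g::real_inner set \<Rightarrow> (('x \<Rightarrow> real) \<Rightarrow> ('x \<Rightarrow> real) \<Rightarrow> real) \<Rightarrow> ('x \<Rightarrow> 'g) \<Rightarrow> ('x \<Rightarrow> 'g) \<Rightarrow> real"
  where
  "ip_g B ip \<mu> \<zeta> = (\<Sum>b\<in>B. \<Sum>c\<in>B. ip (coord B b \<mu>) (coord B c \<zeta>) * (b \<bullet> c))"

definition ip_curl_g ::
    "mesh \<Rightarrow> 'g::real_inner set \<Rightarrow> (R3 set \<Rightarrow> 'g) \<Rightarrow> (R3 set \<Rightarrow> 'g) \<Rightarrow> real" where
  "ip_curl_g M B = ip_g B (ip_curl M)"

definition ip_div_g ::
    "mesh \<Rightarrow> 'g::real_inner set \<Rightarrow> (R3 set \<Rightarrow> 'g) \<Rightarrow> (R3 set \<Rightarrow> 'g) \<Rightarrow> real" where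
  "ip_div_g M B = ip_g B (ip_div M)"

definition norm_curl_g :: "mesh \<Rightarrow> 'g::real_inner set \<Rightarrow> (R3 set \<Rightarrow> 'g) \<Rightarrow> real" where
  "norm_curl_g M B v = sqrt (ip_curl_g M B v v)"

definition norm_div_g :: "mesh \<Rightarrow> 'g::real_inner set \<Rightarrow> (R3 set \<Rightarrow> 'g) \<Rightarrow> real" where
  "norm_div_g M B w = sqrt (ip_div_g M B w w)"

definition X_grad_g :: "mesh \<Rightarrow> 'g::real_vector set \<Rightarrow> (R3 \<Rightarrow> 'g) set" where
  "X_grad_g M B = {q. \<forall>b\<in>B. coord B b q \<in> X_grad M}"

definition X_curl_g :: "mesh \<Rightarrow> 'g::real_vector set \<Rightarrow> (R3 set \<Rightarrow> 'g) set" where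
  "X_curl_g M B = {v. \<forall>b\<in>B. coord B b v \<in> X_curl M}"

definition G_h_g :: "mesh \<Rightarrow> 'g::real_vector set \<Rightarrow> (R3 \<Rightarrow> 'g) \<Rightarrow> R3 set \<Rightarrow> 'g" where
  "G_h_g M B = ext B (G_h M)"

definition C_h_g :: "mesh \<Rightarrow> 'g::real_vector set \<Rightarrow> (R3 set \<Rightarrow> 'g) \<Rightarrow> R3 set \<Rightarrow> 'g" where
  "C_h_g M B = ext B (C_h M)"

text \<open>The elements are disjoint; the value 0 outside them concerns a null subset of the domain.\<close>

definition P_grad_g :: "mesh \<Rightarrow> 'g::real_vector set \<Rightarrow> (R3 \<Rightarrow> 'g) \<Rightarrow> R3 \<Rightarrow> 'g" where
  "P_grad_g M B q x = (\<Sum>T\<in>elems M. if x \<in> T then ext B (P_grad M T) q x else 0)"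

definition P_curl_g :: "mesh \<Rightarrow> 'g::real_vector set \<Rightarrow> (R3 set \<Rightarrow> 'g) \<Rightarrow> R3 \<Rightarrow> 'g^3" where
  "P_curl_g M B v x = (\<Sum>T\<in>elems M. if x \<in> T then ext_vec B (P_curl M T) v else 0)"

definition levi_civita :: "3 \<Rightarrow> 3 \<Rightarrow> 3 \<Rightarrow> real" where
  "levi_civita i j k =
     (if (i, j, k) \<in> {(1, 2, 3), (2, 3, 1), (3, 1, 2)} then 1
      else if (i, j, k) \<in> {(1, 3, 2), (2, 1, 3), (3, 2, 1)} then -1 else 0)"

definition bracket_vec :: "('g \<Rightarrow> 'g \<Rightarrow> 'g) \<Rightarrow> 'g^3 \<Rightarrow> 'g \<Rightarrow> 'g^3" where
  "bracket_vec br v q = (\<chi> i. br (v $ i) q)"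

definition star_bracket :: "('g::real_vector \<Rightarrow> 'g \<Rightarrow> 'g) \<Rightarrow> 'g^3 \<Rightarrow> 'g^3 \<Rightarrow> 'g^3" where
  "star_bracket br v w =
     (\<chi> i. \<Sum>j\<in>UNIV. \<Sum>k\<in>UNIV. levi_civita i j k *\<^sub>R br (v $ j) (w $ k))"

definition star_div ::
    "mesh \<Rightarrow> ('g::real_vector \<Rightarrow> 'g \<Rightarrow> 'g) \<Rightarrow> 'g set \<Rightarrow>
     (R3 set \<Rightarrow> 'g) \<Rightarrow> (R3 set \<Rightarrow> 'g) \<Rightarrow> R3 set \<Rightarrow> 'g" where
  "star_div M br B v w F =
     (\<Sum>i\<in>UNIV. (nrm M F $ i) *\<^sub>R
        (star_bracket br (ext_vec B (gamma_t M F) v) (ext_vec B (gamma_t M F) w) $ i))"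

definition magnetic ::
    "mesh \<Rightarrow> ('g::real_vector \<Rightarrow> 'g \<Rightarrow> 'g) \<Rightarrow> 'g set \<Rightarrow> (R3 set \<Rightarrow> 'g) \<Rightarrow> R3 set \<Rightarrow> 'g" where
  "magnetic M br B A = (\<lambda>F. C_h_g M B A F + (1/2) *\<^sub>R star_div M br B A A F)"

definition delta_t :: "(nat \<Rightarrow> real) \<Rightarrow> (nat \<Rightarrow> 'x \<Rightarrow> 'g::real_vector) \<Rightarrow> nat \<Rightarrow> 'x \<Rightarrow> 'g" where
  "delta_t t Z n = (\<lambda>x. (1 / (t (Suc n) - t n)) *\<^sub>R (Z (Suc n) x - Z n x))"

text \<open>\<open>interp Z n s\<close> is \<open>Z\<close> at the fractional index \<open>n + s\<close>.\<close>

definition interp :: "(nat \<Rightarrow> 'x \<Rightarrow> 'g::real_vector) \<Rightarrow> nat \<Rightarrow> real \<Rightarrow> 'x \<Rightarrow> 'g" where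
  "interp Z n s = (\<lambda>x. s *\<^sub>R Z (Suc n) x + (1 - s) *\<^sub>R Z n x)"

definition constrained_scheme ::
    "mesh \<Rightarrow> ('g::real_inner \<Rightarrow> 'g \<Rightarrow> 'g) \<Rightarrow> 'g set \<Rightarrow> real \<Rightarrow> nat \<Rightarrow> (nat \<Rightarrow> real) \<Rightarrow>
     (nat \<Rightarrow> R3 set \<Rightarrow> 'g) \<Rightarrow> (nat \<Rightarrow> R3 set \<Rightarrow> 'g) \<Rightarrow> (nat \<Rightarrow> R3 \<Rightarrow> 'g) \<Rightarrow> bool" where
  "constrained_scheme M br B \<theta> N t A E lam \<longleftrightarrow>
     (\<forall>n<N.
        delta_t t A n = (\<lambda>e. - interp E n \<theta> e) \<and>
        (\<forall>v\<in>X_curl_g M B.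
           ip_curl_g M B (delta_t t E n) v +
           ip_curl_g M B (G_h_g M B (lam (Suc n))) v +
           (LINT x:region M|lborel.
              bracket_vec br (P_curl_g M B (interp A n \<theta>) x) (P_grad_g M B (lam (Suc n)) x)
                \<bullet> P_curl_g M B v x) =
           ip_div_g M B (interp (\<lambda>k. magnetic M br B (A k)) n \<theta>)
             (\<lambda>F. C_h_g M B v F + star_div M br B (interp A n (1/2)) v F)) \<and>
        (\<forall>q\<in>X_grad_g M B.
           ip_curl_g M B (delta_t t E n) (G_h_g M B q) +
           (LINT x:region M|lborel.
              P_curl_g M B (delta_t t E n) x \<bullet>
                bracket_vec br (P_curl_g M B (interp A n (1 - \<theta>)) x) (P_grad_g M B q x)) = 0))"

definition constraint ::
    "mesh \<Rightarrow> ('g::real_inner \<Rightarrow> 'g \<Rightarrow> 'g) \<Rightarrow> 'g set \<Rightarrow>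
     (R3 set \<Rightarrow> 'g) \<Rightarrow> (R3 set \<Rightarrow> 'g) \<Rightarrow> (R3 \<Rightarrow> 'g) \<Rightarrow> real" where
  "constraint M br B A E q =
     ip_curl_g M B E (G_h_g M B q) +
     (LINT x:region M|lborel.
        P_curl_g M B E x \<bullet> bracket_vec br (P_curl_g M B A x) (P_grad_g M B q x))"

end

theory Submission
  imports Defs
begin

text \<open>
  Test the evolution equation with \<open>v = E\<^sup>n\<^sup>+\<^sup>1\<close>. Since \<open>A\<^sup>n\<^sup>+\<^sup>1 - A\<^sup>n = - h E\<^sup>n\<^sup>+\<^sup>1\<close> with the time step \<open>h\<close>,
  and since the discrete bracket is bilinear and symmetric, the field \<open>C v + \<star>[A, v]\<close> taken at the
  midpoint \<open>A\<close> of \<open>A\<^sup>n\<close> and \<open>A\<^sup>n\<^sup>+\<^sup>1\<close> is exactly \<open>- (B\<^sup>n\<^sup>+\<^sup>1 - B\<^sup>n) / h\<close>: this is the polarisation identity for the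
  quadratic part of the magnetic field (\<open>magnetic_increment\<close>). What remains is
  \<open>(E\<^sup>n\<^sup>+\<^sup>1 - E\<^sup>n, E\<^sup>n\<^sup>+\<^sup>1) + (B\<^sup>n\<^sup>+\<^sup>1 - B\<^sup>n, B\<^sup>n\<^sup>+\<^sup>1) = - h\<close> times the two terms with the multiplier, and these
  add up to the constraint functional at time \<open>n + 1\<close> applied to the multiplier. If that vanishes,
  \<open>x\<^sup>2 - y\<^sup>2 \<le> 2 (x - y, x)\<close>, valid for every positive semidefinite form, gives the energy estimate
  (\<open>energy_step\<close>).

  The constraint functional is preserved exactly (\<open>constraint_step\<close>). Replacing \<open>A\<^sup>n\<^sup>+\<^sup>1\<close> by \<open>A\<^sup>n\<close> in the
  constraint at time \<open>n + 1\<close> changes it by a multiple of the integral of \<open>\<langle>E, [E, q]\<rangle>\<close> with \<open>E = E\<^sup>n\<^sup>+\<^sup>1\<close>,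
  which is zero by invariance of the inner product. With \<open>A\<^sup>n\<close> fixed, the constraint is linear in
  \<open>E\<close>, and the third equation of the scheme says that its increment vanishes.

  Both arguments presuppose that the discrete operators are linear, that the two discrete products
  are positive semidefinite, and that the coupling integrals are additive. The potentials are
  defined as the unique solutions of local variational problems, so linearity is the well-posedness
  of these problems. They all reduce to one statement, that a bilinear form which is nondegenerate
  on a subspace represents every linear functional by a unique vector
  (\<open>ex1_representing_vector\<close>), plus linearity of integrals over bounded cells. Additivity of the
  coupling integrals needs that the reconstructed potential of \<open>q\<close> really is piecewise affine
  (\<open>P_grad_poly1\<close>). Nondegeneracy comes from the geometry: elements and faces are relatively open,
  so a continuous function whose square has integral zero vanishes on the cell.
\<close>

section \<open>Linear operators on functions and representation of functionals\<close>

text \<open>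
  Function types carry no vector space structure, so linearity in a function argument is stated
  for pointwise linear combinations.
\<close>

definition linear_op :: "(('x \<Rightarrow> 'a::real_vector) \<Rightarrow> 'b::real_vector) \<Rightarrow> bool" where
  "linear_op L \<longleftrightarrow> (\<forall>v w a b. L (\<lambda>x. a *\<^sub>R v x + b *\<^sub>R w x) = a *\<^sub>R L v + b *\<^sub>R L w)"

lemma linear_opD: "linear_op L \<Longrightarrow> L (\<lambda>x. a *\<^sub>R v x + b *\<^sub>R w x) = a *\<^sub>R L v + b *\<^sub>R L w"
  by (simp add: linear_op_def)

lemma linear_op_eval: "linear_op (\<lambda>v. v x)"
  by (simp add: linear_op_def)

lemma linear_op_linear: "linear f \<Longrightarrow> linear_op L \<Longrightarrow> linear_op (\<lambda>v. f (L v))"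
  by (simp add: linear_op_def linear_add linear_scale)

lemma linear_op_add: "linear_op L \<Longrightarrow> linear_op K \<Longrightarrow> linear_op (\<lambda>v. L v + K v)"
  by (simp add: linear_op_def scaleR_right_distrib)

lemma linear_op_diff: "linear_op L \<Longrightarrow> linear_op K \<Longrightarrow> linear_op (\<lambda>v. L v - K v)"
  by (simp add: linear_op_def scaleR_right_diff_distrib)

lemma linear_op_mult: "linear_op L \<Longrightarrow> linear_op (\<lambda>v. c * L v)"
  for L :: "('x \<Rightarrow> 'a::real_vector) \<Rightarrow> real"
  by (simp add: linear_op_def algebra_simps)

lemma linear_op_mult_left: "linear_op L \<Longrightarrow> linear_op (\<lambda>v. L v * c)"
  for L :: "('x \<Rightarrow> 'a::real_vector) \<Rightarrow> real"
  by (simp add: linear_op_def algebra_simps)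

lemma linear_op_scaleR: "linear_op L \<Longrightarrow> linear_op (\<lambda>v. c *\<^sub>R L v)"
  by (simp add: linear_op_def algebra_simps)

lemma linear_op_scaleR_left: "linear_op L \<Longrightarrow> linear_op (\<lambda>v. L v *\<^sub>R c)"
  by (simp add: linear_op_def algebra_simps)

lemma linear_op_inner_left: "linear_op L \<Longrightarrow> linear_op (\<lambda>v. L v \<bullet> c)"
  for L :: "('x \<Rightarrow> 'a::real_vector) \<Rightarrow> 'b::real_inner"
  by (simp add: linear_op_def inner_add_left)

lemma linear_op_sum: "(\<And>i. i \<in> I \<Longrightarrow> linear_op (L i)) \<Longrightarrow> linear_op (\<lambda>v. \<Sum>i\<in>I. L i v)"
  by (simp add: linear_op_def sum.distrib scaleR_sum_right)

lemmas linear_op_intros =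
  linear_op_eval linear_op_add linear_op_diff linear_op_mult linear_op_mult_left
  linear_op_scaleR linear_op_scaleR_left linear_op_inner_left linear_op_sum

lemmas linear_scaled_functional =
  linear_compose_scale_right[where 'b = real, unfolded real_scaleR_def]

text \<open>
  The finite-dimensional Lax-Milgram argument: through an orthonormal basis of \<open>W\<close> the form
  becomes an endomorphism \<open>T\<close> of \<open>W\<close>; nondegeneracy makes it injective, hence bijective by dimension.
\<close>

lemma ex1_representing_vector:
  fixes W :: "'a::euclidean_space set" and \<beta> :: "'a \<Rightarrow> 'a \<Rightarrow> real"
  assumes W: "subspace W" and \<beta>: "bilinear \<beta>" and l: "linear l"
    and nondeg: "\<And>g. g \<in> W \<Longrightarrow> (\<And>w. w \<in> W \<Longrightarrow> \<beta> g w = 0) \<Longrightarrow> g = 0"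
  shows "\<exists>!g. g \<in> W \<and> (\<forall>w\<in>W. \<beta> g w = l w)"
proof -
  obtain Q where Q: "0 \<notin> Q" "Q \<subseteq> W" "pairwise orthogonal Q" "\<And>x. x \<in> Q \<Longrightarrow> norm x = 1"
      "independent Q" "card Q = dim W" "span Q = W"
    using orthonormal_basis_subspace[OF W] by (metis norm_zero zero_neq_one)
  have finQ: "finite Q" using Q(5) by (rule independent_imp_finite)
  have expand: "(\<Sum>q\<in>Q. f q *\<^sub>R q) \<bullet> w = f w" if f: "linear f" and w: "w \<in> W"
    for f :: "'a \<Rightarrow> real" and w
  proof -
    let ?r = "\<Sum>q\<in>Q. f q *\<^sub>R q"
    have rq: "?r \<bullet> q = f q" if "q \<in> Q" for q
    proof -
      have "?r \<bullet> q = (\<Sum>p\<in>Q. f p * (p \<bullet> q))" by (simp add: inner_sum_left)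
      also have "\<dots> = (\<Sum>p\<in>Q. if p = q then f q else 0)"
        using Q(3,4) that
        by (intro sum.cong) (auto simp: pairwise_def orthogonal_def norm_eq_1)
      finally show ?thesis using finQ that by simp
    qed
    have lr: "linear (\<lambda>w. ?r \<bullet> w)" by (rule bounded_linear.linear[OF bounded_linear_inner_right])
    show ?thesis using linear_eq_on[OF lr f _ rq] w Q(7) by blast
  qed
  have in_W: "(\<Sum>q\<in>Q. f q *\<^sub>R q) \<in> W" for f
    using Q(2) by (intro subspace_sum[OF W] subspace_scale[OF W]) auto
  define T where "T g = (\<Sum>q\<in>Q. \<beta> g q *\<^sub>R q)" for g
  have lin: "linear (\<lambda>g. \<beta> g w)" "linear (\<beta> g)" for w g using \<beta> by (auto simp: bilinear_def)
  have linT: "linear T" unfolding T_def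
    by (intro linearI) (simp_all add: linear_add[OF lin(1)] linear_scale[OF lin(1)] sum.distrib
        scaleR_left_distrib scaleR_sum_right)
  have TW: "T g \<in> W" for g unfolding T_def by (rule in_W)
  have Tq: "T g \<bullet> w = \<beta> g w" if "w \<in> W" for g w
    unfolding T_def using lin(2) that by (rule expand)
  have inj: "inj_on T W"
  proof (rule linear_inj_on_iff_eq_0[OF linT W, THEN iffD2], intro ballI impI)
    fix g assume "g \<in> W" "T g = 0"
    then show "g = 0" using nondeg[of g] Tq[of _ g] by auto
  qed
  have surj: "T ` W = W"
  proof (rule subspace_dim_equal)
    show "subspace (T ` W)" using linT W by (rule linear_subspace_image)
    show "subspace W" by fact
    show "T ` W \<subseteq> W" using TW by auto
    have sW: "span W = W" using W by (rule span_eq_iff[THEN iffD2])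
    have "dim (T ` W) = dim W" by (rule dim_image_eq[OF linT]) (simp only: sW inj)
    then show "dim W \<le> dim (T ` W)" by simp
  qed
  obtain r where r: "r \<in> W" "\<forall>w\<in>W. r \<bullet> w = l w" using in_W expand[OF l] by blast
  have "r \<in> T ` W" using surj r(1) by simp
  then obtain g where g: "g \<in> W" "T g = r" by blast
  show ?thesis
  proof (rule ex1I[of _ g])
    show "g \<in> W \<and> (\<forall>w\<in>W. \<beta> g w = l w)" using g r Tq[of _ g] by auto
    fix h assume h: "h \<in> W \<and> (\<forall>w\<in>W. \<beta> h w = l w)"
    have "h - g = 0"
    proof (rule nondeg)
      show "h - g \<in> W" using h g W by (simp add: subspace_diff)
      fix w assume "w \<in> W"
      then show "\<beta> (h - g) w = 0"
        using h g r Tq by (metis linear_diff[OF lin(1)] diff_self)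
    qed
    then show "h = g" by simp
  qed
qed

text \<open>
  Unique solvability turns linear dependence of the data into linear dependence of the solution.
  The tangential trace on faces, the element curl and the potentials for curl and div have this shape.
\<close>

lemma linear_op_representing_vector:
  fixes W :: "'a::euclidean_space set"
  assumes W: "subspace W" and lw: "\<And>v. linear (l v)"
    and lv: "\<And>w. w \<in> W \<Longrightarrow> linear_op (\<lambda>v. l v w)"
  shows "linear_op (\<lambda>v. THE g. g \<in> W \<and> (\<forall>w\<in>W. g \<bullet> w = l v w))"
proof -
  have ex: "\<exists>!g. g \<in> W \<and> (\<forall>w\<in>W. g \<bullet> w = l v w)" for v
  proof (rule ex1_representing_vector[OF W _ lw])
    show "bilinear ((\<bullet>) :: 'a \<Rightarrow> 'a \<Rightarrow> real)"
      by (simp add: bilinear_conv_bounded_bilinear bounded_bilinear_inner)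
    show "g = 0" if "g \<in> W" "\<And>w. w \<in> W \<Longrightarrow> g \<bullet> w = 0" for g
      using that(2)[OF that(1)] by simp
  qed
  define R where "R v = (THE g. g \<in> W \<and> (\<forall>w\<in>W. g \<bullet> w = l v w))" for v
  have R: "R v \<in> W" "\<And>w. w \<in> W \<Longrightarrow> R v \<bullet> w = l v w" for v
    using theI'[OF ex[of v]] by (auto simp: R_def)
  have "linear_op R"
    unfolding linear_op_def
  proof (intro allI)
    fix v w a b
    show "R (\<lambda>x. a *\<^sub>R v x + b *\<^sub>R w x) = a *\<^sub>R R v + b *\<^sub>R R w" (is "R ?u = _")
      unfolding R_def[of ?u]
    proof (rule the1_equality[OF ex], intro conjI ballI)
      show "a *\<^sub>R R v + b *\<^sub>R R w \<in> W"
        using R(1) W by (simp add: subspace_add subspace_scale)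
      fix z assume "z \<in> W"
      then show "(a *\<^sub>R R v + b *\<^sub>R R w) \<bullet> z = l ?u z"
        using linear_opD[OF lv[of z], of a v b w] R(2) by (simp add: inner_add_left)
    qed
  qed
  then show ?thesis by (simp add: R_def[abs_def])
qed

section \<open>Integration over cells\<close>

text \<open>Elements with volume, faces with area and edges with arc length are treated uniformly.\<close>

locale bounded_cell =
  fixes \<nu> :: "R3 measure" and S :: "R3 set"
  assumes sets_eq: "sets \<nu> = sets borel"
    and S_borel: "S \<in> sets borel" and S_bounded: "bounded S"
    and finite_measure: "emeasure \<nu> S < \<infinity>"
begin

lemma set_integrable_continuous:
  fixes f :: "R3 \<Rightarrow> real"
  assumes f: "continuous_on (closure S) f"
  shows "set_integrable \<nu> S f"
proof -
  have "compact (f ` closure S)"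
    using f S_bounded by (intro compact_continuous_image) (auto simp: compact_closure)
  then obtain C where C: "\<And>x. x \<in> closure S \<Longrightarrow> norm (f x) \<le> C"
    using compact_imp_bounded bounded_iff by (metis image_eqI)
  have meas: "(\<lambda>x. indicator S x *\<^sub>R f x) \<in> borel_measurable \<nu>"
    using borel_measurable_continuous_on_indicator[OF S_borel continuous_on_subset[OF f closure_subset]]
    by (simp add: measurable_cong_sets[OF sets_eq refl])
  show ?thesis
    unfolding set_integrable_def
  proof (rule integrableI_bounded_set[where A=S and B=C])
    show "S \<in> sets \<nu>" using S_borel sets_eq by simp
    show "emeasure \<nu> S < \<infinity>" by (rule finite_measure)
    show "AE x\<in>S in \<nu>. norm (indicat_real S x *\<^sub>R f x) \<le> C"
      using C closure_subset by (intro AE_I2) (auto simp: indicator_def)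
  qed (use meas in \<open>auto simp: indicator_def\<close>)
qed

lemma integral_lincomb:
  fixes f g :: "R3 \<Rightarrow> real"
  assumes "continuous_on (closure S) f" "continuous_on (closure S) g"
  shows "(LINT x:S|\<nu>. a * f x + b * g x) = a * (LINT x:S|\<nu>. f x) + b * (LINT x:S|\<nu>. g x)"
  using assms by (simp add: set_integrable_continuous)

lemma linear_integral:
  fixes f :: "'v::real_vector \<Rightarrow> R3 \<Rightarrow> real"
  assumes c: "\<And>\<xi>. continuous_on (closure S) (f \<xi>)" and lin: "\<And>x. linear (\<lambda>\<xi>. f \<xi> x)"
  shows "linear (\<lambda>\<xi>. LINT x:S|\<nu>. f \<xi> x)"
proof (rule linearI)
  fix \<xi> \<eta> r
  show "(LINT x:S|\<nu>. f (\<xi> + \<eta>) x) = (LINT x:S|\<nu>. f \<xi> x) + (LINT x:S|\<nu>. f \<eta> x)"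
    using c by (simp add: linear_add[OF lin] set_integrable_continuous)
  show "(LINT x:S|\<nu>. f (r *\<^sub>R \<xi>) x) = r *\<^sub>R (LINT x:S|\<nu>. f \<xi> x)"
    by (simp add: linear_scale[OF lin])
qed

lemma linear_op_integral:
  fixes f :: "('x \<Rightarrow> 'a::real_vector) \<Rightarrow> R3 \<Rightarrow> real"
  assumes c: "\<And>v. continuous_on (closure S) (f v)" and lin: "\<And>x. linear_op (\<lambda>v. f v x)"
  shows "linear_op (\<lambda>v. LINT x:S|\<nu>. f v x)"
  unfolding linear_op_def
proof (intro allI)
  fix v w a b
  show "(LINT x:S|\<nu>. f (\<lambda>x. a *\<^sub>R v x + b *\<^sub>R w x) x) =
      a *\<^sub>R (LINT x:S|\<nu>. f v x) + b *\<^sub>R (LINT x:S|\<nu>. f w x)"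
    using integral_lincomb[OF c c, of a v b w] by (simp add: linear_opD[OF lin])
qed

end

lemma set_integral_const: "(LINT x:S|\<nu>. c) = c * measure \<nu> S" if "S \<in> sets \<nu>" for c :: real
proof -
  have "(LINT x:S|\<nu>. c) = (LINT x|\<nu>. c * indicator S x)"
    by (simp add: set_lebesgue_integral_def mult.commute)
  also have "\<dots> = c * measure \<nu> (S \<inter> space \<nu>)" by simp
  finally show ?thesis using sets.sets_into_space[OF that] by (simp add: Int_absorb2)
qed

text \<open>
  Full support of the measure is what makes the \<open>L\<^sup>2\<close> product of affine functions definite.
\<close>

locale full_cell = bounded_cell +
  assumes nonempty: "S \<noteq> {}"
    and full_support: "\<And>x V. x \<in> S \<Longrightarrow> open V \<Longrightarrow> x \<in> V \<Longrightarrow> emeasure \<nu> (S \<inter> V) > 0"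
begin

lemma measure_pos: "measure \<nu> S > 0"
proof -
  obtain x where "x \<in> S" using nonempty by blast
  then have "emeasure \<nu> S > 0" using full_support[of x UNIV] by simp
  then show ?thesis using finite_measure by (simp add: measure_def enn2real_positive_iff)
qed

lemma integral_square_zero:
  fixes f :: "R3 \<Rightarrow> real"
  assumes f: "continuous_on UNIV f" and 0: "(LINT x:S|\<nu>. f x * f x) = 0" and x: "x \<in> S"
  shows "f x = 0"
proof (rule ccontr)
  assume fx: "f x \<noteq> 0"
  have c: "continuous_on (closure S) (\<lambda>x. f x * f x)"
    by (intro continuous_intros continuous_on_subset[OF f]) auto
  have "integrable \<nu> (\<lambda>x. indicator S x *\<^sub>R (f x * f x))"
    using set_integrable_continuous[OF c] by (simp add: set_integrable_def)
  then have "AE x in \<nu>. indicator S x *\<^sub>R (f x * f x) = 0"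
    using 0 by (subst integral_nonneg_eq_0_iff_AE[symmetric])
      (auto simp: set_lebesgue_integral_def)
  then obtain N where N: "{x \<in> space \<nu>. indicator S x *\<^sub>R (f x * f x) \<noteq> 0} \<subseteq> N"
      "emeasure \<nu> N = 0" "N \<in> sets \<nu>" by (rule AE_E)
  have V: "open (f -` (- {0}))"
    using open_vimage[of "- {0}" f] f by (simp add: open_Compl)
  have "space \<nu> = UNIV" using sets_eq_imp_space_eq[OF sets_eq] by simp
  then have "S \<inter> f -` (- {0}) \<subseteq> N" using N(1) by (auto simp: subset_iff indicator_def)
  then have "emeasure \<nu> (S \<inter> f -` (- {0})) \<le> emeasure \<nu> N" using N(3) by (rule emeasure_mono)
  then show False using full_support[OF x V] fx N(2) by simp
qed

end

lemma subspace_tangent_space: "subspace (tangent_space S)"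
  by (simp add: tangent_space_def)

lemma diff_in_tangent_space: "x \<in> S \<Longrightarrow> y \<in> S \<Longrightarrow> x - y \<in> tangent_space S"
  unfolding tangent_space_def by (rule span_base) auto

text \<open>
  The normalisation of affine functions by gradients in the tangent space makes them determined
  by their values on the cell.
\<close>

lemma affine_zero_on_cell:
  assumes S: "S \<noteq> {}" and a: "a \<in> tangent_space S" and z: "\<And>x. x \<in> S \<Longrightarrow> a \<bullet> x + b = 0"
  shows "a = 0 \<and> b = 0"
proof -
  have perp: "a \<bullet> u = 0" if "u \<in> tangent_space S" for u
    using that unfolding tangent_space_def
  proof (induction rule: span_induct)
    case base show ?case
      by (auto intro!: subspaceI simp: inner_add_right)
  next
    case (step u)
    then obtain x y where u: "u = x - y" "x \<in> S" "y \<in> S" by auto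
    show ?case using z[OF u(2)] z[OF u(3)] by (simp add: u(1) inner_diff_right)
  qed
  have "a = 0" using perp[OF a] by simp
  then show ?thesis using S z by auto
qed

context full_cell
begin

text \<open>
  For the test field \<open>v = p(x) (x - p\<^sub>0)\<close> with \<open>p\<close> affine, the divergence on a cell of dimension \<open>k\<close> is
  \<open>k p(x) + a \<bullet> (x - p\<^sub>0)\<close>, where \<open>a\<close> is the gradient of \<open>p\<close>. This map is a bijection of the affine
  functions: it multiplies the linear part about \<open>p\<^sub>0\<close> by \<open>k + 1\<close> and the constant part by \<open>k\<close>. So a
  function orthogonal to all these divergences is orthogonal to itself. With \<open>k = 2\<close> and \<open>k = 3\<close> the
  lemma is the well-posedness of the face and element potentials.
\<close>

lemma ex1_poly1:
  assumes k: "k > 0"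
    and l: "linear (\<lambda>(a, b). l (\<lambda>x. a \<bullet> x + b))"
  shows "\<exists>!g. g \<in> poly1 S \<and>
    (\<forall>a\<in>tangent_space S. \<forall>b.
      (LINT x:S|\<nu>. g x * (k * (a \<bullet> x + b) + a \<bullet> (x - p))) = l (\<lambda>x. a \<bullet> x + b))"
proof -
  define W where "W = tangent_space S \<times> (UNIV :: real set)"
  define \<phi> :: "R3 \<times> real \<Rightarrow> R3 \<Rightarrow> real" where "\<phi> = (\<lambda>(a, b) x. a \<bullet> x + b)"
  define d :: "R3 \<times> real \<Rightarrow> R3 \<Rightarrow> real" where
    "d = (\<lambda>(a, b) x. k * (a \<bullet> x + b) + a \<bullet> (x - p))"
  define \<beta> where "\<beta> u w = (LINT x:S|\<nu>. \<phi> u x * d w x)" for u w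
  have W: "subspace W" unfolding W_def by (intro subspace_Times subspace_tangent_space subspace_UNIV)
  have c\<phi>: "continuous_on T (\<phi> u)" and cd: "continuous_on T (d u)" for u T
    by (cases u; simp add: \<phi>_def d_def; intro continuous_intros)+
  have l\<phi>: "linear (\<lambda>u. \<phi> u x)" and ld: "linear (\<lambda>u. d u x)" for x
    by (rule linearI; auto simp: \<phi>_def d_def algebra_simps inner_add_left split: prod.splits)+
  have \<beta>: "bilinear \<beta>"
    unfolding bilinear_def \<beta>_def
    by (intro conjI allI linear_integral continuous_intros c\<phi> cd)
      (simp_all add: linear_compose[OF ld bounded_linear.linear[OF bounded_linear_mult_right],
        unfolded o_def] linear_compose[OF l\<phi> bounded_linear.linear[OF bounded_linear_mult_left],
        unfolded o_def])
  have nondeg: "g = 0" if g: "g \<in> W" and z: "\<And>w. w \<in> W \<Longrightarrow> \<beta> g w = 0" for g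
  proof -
    obtain a b where ab: "g = (a, b)" by fastforce
    have a: "a \<in> tangent_space S" using g ab by (simp add: W_def)
    (* The test function ?w is chosen such that its divergence is g itself. *)
    define c where "c = 1 / (k + 1)"
    have kc: "k * c + c = 1" using k by (simp add: c_def field_simps)
    define b' where "b' = (b + c * (a \<bullet> p)) / k"
    have kb: "k * b' = b + c * (a \<bullet> p)" using k by (simp add: b'_def)
    let ?w = "(c *\<^sub>R a, b')"
    have "?w \<in> W" using a by (simp add: W_def subspace_scale subspace_tangent_space)
    then have "\<beta> g ?w = 0" by (rule z)
    moreover have "d ?w x = \<phi> g x" for x
    proof -
      have "d ?w x = (k * c + c) * (a \<bullet> x) + b"
        using kb by (simp add: d_def inner_diff_right algebra_simps)
      then show ?thesis by (simp only: kc) (simp add: \<phi>_def ab)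
    qed
    ultimately have "(LINT x:S|\<nu>. \<phi> g x * \<phi> g x) = 0" by (simp add: \<beta>_def)
    then have "a \<bullet> x + b = 0" if "x \<in> S" for x
      using integral_square_zero[OF c\<phi> _ that, of g] by (simp add: \<phi>_def ab)
    then show "g = 0" using affine_zero_on_cell[OF nonempty a, of b] by (simp add: ab zero_prod_def)
  qed
  have "\<exists>!u. u \<in> W \<and> (\<forall>w\<in>W. \<beta> u w = (\<lambda>(a, b). l (\<lambda>x. a \<bullet> x + b)) w)"
    by (rule ex1_representing_vector[OF W \<beta> l nondeg])
  then obtain u where u: "u \<in> W" "\<And>w. w \<in> W \<Longrightarrow> \<beta> u w = (\<lambda>(a, b). l (\<lambda>x. a \<bullet> x + b)) w"
    and uni: "\<And>u'. u' \<in> W \<Longrightarrow> (\<And>w. w \<in> W \<Longrightarrow> \<beta> u' w = (\<lambda>(a, b). l (\<lambda>x. a \<bullet> x + b)) w) \<Longrightarrow> u' = u"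
    by (elim ex1E) blast
  show ?thesis
  proof (rule ex1I[of _ "\<phi> u"], intro conjI ballI allI)
    show "\<phi> u \<in> poly1 S" using u(1) by (auto simp: \<phi>_def W_def poly1_def)
    show "(LINT x:S|\<nu>. \<phi> u x * (k * (a \<bullet> x + b) + a \<bullet> (x - p))) = l (\<lambda>x. a \<bullet> x + b)"
      if "a \<in> tangent_space S" for a b
      using u(2)[of "(a, b)"] that by (simp add: W_def \<beta>_def d_def)
    fix h assume h: "h \<in> poly1 S \<and> (\<forall>a\<in>tangent_space S. \<forall>b.
      (LINT x:S|\<nu>. h x * (k * (a \<bullet> x + b) + a \<bullet> (x - p))) = l (\<lambda>x. a \<bullet> x + b))"
    then obtain a b where ab: "h = (\<lambda>x. a \<bullet> x + b)" "a \<in> tangent_space S"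
      by (auto simp: poly1_def)
    have h\<phi>: "h = \<phi> (a, b)" using ab by (simp add: \<phi>_def)
    have "(a, b) = u"
    proof (rule uni)
      show "(a, b) \<in> W" using ab by (simp add: W_def)
      fix w assume "w \<in> W"
      then show "\<beta> (a, b) w = (\<lambda>(a, b). l (\<lambda>x. a \<bullet> x + b)) w"
        using h by (cases w) (simp add: W_def \<beta>_def d_def h\<phi>[symmetric])
    qed
    then show "h = \<phi> u" using h\<phi> by simp
  qed
qed

text \<open>
  Affine functions of mean zero are parametrised linearly by their gradients, which converts the
  variational problems over them into problems over vectors.
\<close>

lemma mean_zero_poly1:
  "{r \<in> poly1 S. (LINT x:S|\<nu>. r x) = 0} =
    (\<lambda>a x. a \<bullet> x - (LINT y:S|\<nu>. a \<bullet> y) / measure \<nu> S) ` tangent_space S"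
proof -
  have I: "(LINT x:S|\<nu>. a \<bullet> x + b) = (LINT y:S|\<nu>. a \<bullet> y) + b * measure \<nu> S" for a b
  proof -
    have "(LINT x:S|\<nu>. a \<bullet> x + b) = (LINT x:S|\<nu>. 1 * (a \<bullet> x) + b * 1)" by simp
    also have "\<dots> = 1 * (LINT y:S|\<nu>. a \<bullet> y) + b * (LINT y:S|\<nu>. 1)"
      by (rule integral_lincomb) (intro continuous_intros)+
    finally show ?thesis using S_borel sets_eq by (simp add: set_integral_const)
  qed
  show ?thesis (is "?L = ?R")
  proof
    show "?L \<subseteq> ?R"
    proof
      fix r assume "r \<in> ?L"
      then obtain a b where r: "r = (\<lambda>x. a \<bullet> x + b)" "a \<in> tangent_space S" "(LINT x:S|\<nu>. r x) = 0"
        by (auto simp: poly1_def)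
      then have "b = - ((LINT y:S|\<nu>. a \<bullet> y) / measure \<nu> S)"
        using I[of a b] measure_pos by (simp add: field_simps)
      then show "r \<in> ?R" using r by auto
    qed
    have "(LINT x:S|\<nu>. a \<bullet> x - (LINT y:S|\<nu>. a \<bullet> y) / measure \<nu> S) = 0" for a
      using I[of a "- ((LINT y:S|\<nu>. a \<bullet> y) / measure \<nu> S)"] measure_pos by simp
    moreover have "(\<lambda>x. a \<bullet> x - c) \<in> poly1 S" if "a \<in> tangent_space S" for a c
      unfolding poly1_def using that by (intro CollectI exI[of _ a] exI[of _ "- c"]) simp
    ultimately show "?R \<subseteq> ?L" by auto
  qed
qed

lemma linear_mean: "linear (\<lambda>a. (LINT y:S|\<nu>. a \<bullet> y) / measure \<nu> S)"
  using linear_compose[OF linear_integral[of "\<lambda>a y. a \<bullet> y"], of "\<lambda>c. c / measure \<nu> S"]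
  by (simp add: o_def continuous_on_inner bounded_linear.linear[OF bounded_linear_inner_left]
      bounded_linear.linear[OF bounded_linear_divide])

end

section \<open>Geometry of elements, faces and edges\<close>

lemma continuous_on_cross3 [continuous_intros]:
  "continuous_on S f \<Longrightarrow> continuous_on S g \<Longrightarrow> continuous_on S (\<lambda>x. cross3 (f x) (g x))"
  for S :: "'a::t2_space set"
  by (rule continuous_on_cross)

lemma linear_cross_left: "linear (\<lambda>u. cross3 u v)" and linear_cross_right: "linear (\<lambda>v. cross3 u v)"
  using bilinear_cross by (auto simp: bilinear_def)

lemma cross_frame_expansion:
  assumes n: "norm n = 1" and a: "norm a = 1" "a \<bullet> n = 0" and y: "n \<bullet> y = 0"
  shows "y = (y \<bullet> a) *\<^sub>R a + (y \<bullet> cross3 n a) *\<^sub>R cross3 n a"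
proof -
  have nn: "n \<bullet> n = 1" "a \<bullet> a = 1" using n a by (simp_all add: norm_eq_1)
  let ?m = "cross3 n a"
  have m: "?m \<bullet> ?m = 1" "a \<bullet> ?m = 0" "n \<bullet> ?m = 0"
    using nn a(2) by (simp_all add: dot_cross dot_cross_self inner_commute)
  define z where "z = y - ((y \<bullet> a) *\<^sub>R a + (y \<bullet> ?m) *\<^sub>R ?m)"
  have z: "z \<bullet> n = 0" "z \<bullet> a = 0" "z \<bullet> ?m = 0"
    using nn m a(2) y
    by (simp_all add: z_def inner_diff_left inner_add_left inner_commute[of a n]
        inner_commute[of "cross3 n a" n] inner_commute[of "cross3 n a" a] inner_commute[of y n])
  then have "cross3 z ?m = 0" by (simp add: Lagrange)
  then have "z = 0" using z(3) m(1) norm_and_cross_eq_0[of z ?m] by auto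
  then show ?thesis by (simp add: z_def)
qed

lemma bounded_cell_lborel: "open T \<Longrightarrow> bounded T \<Longrightarrow> bounded_cell lborel T"
  using emeasure_bounded_finite[of T] by (simp add: bounded_cell_def)

lemma emeasure_lborel_open_pos:
  fixes V :: "'a::euclidean_space set"
  assumes "open V" "V \<noteq> {}"
  shows "emeasure lborel V > 0"
proof (rule ccontr)
  assume "\<not> ?thesis"
  then have "V \<in> null_sets lborel" using assms by (simp add: null_sets_def)
  then have "negligible V" by (simp add: negligible_iff_null_sets null_sets_completionI)
  then show False using open_not_negligible[OF assms] by simp
qed

lemma full_cell_lborel: "open T \<Longrightarrow> bounded T \<Longrightarrow> T \<noteq> {} \<Longrightarrow> full_cell lborel T"
  unfolding full_cell_def full_cell_axioms_def
  by (auto intro!: bounded_cell_lborel emeasure_lborel_open_pos)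

lemma line_measure_bounded_cell:
  assumes "norm t = 1" "bounded S" "S \<in> sets borel"
  shows "bounded_cell (line_measure p t) S"
proof -
  have m: "(\<lambda>s. p + s *\<^sub>R t) \<in> lborel \<rightarrow>\<^sub>M borel" by measurable
  obtain C where C: "\<And>x. x \<in> S \<Longrightarrow> norm x \<le> C" using assms(2) by (auto simp: bounded_iff)
  have "norm s \<le> norm p + C" if "p + s *\<^sub>R t \<in> S" for s
  proof -
    have "norm (s *\<^sub>R t) \<le> norm (p + s *\<^sub>R t) + norm p"
      using norm_triangle_ineq4[of "p + s *\<^sub>R t" p] by simp
    then show ?thesis using C[OF that] assms(1) by simp
  qed
  then have "bounded ((\<lambda>s. p + s *\<^sub>R t) -` S)" by (auto simp: bounded_iff)
  then show ?thesis
    using assms emeasure_bounded_finite[of "(\<lambda>s. p + s *\<^sub>R t) -` S"]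
    by (simp add: bounded_cell_def line_measure_def emeasure_distr[OF m])
qed

lemma orthonormal_vector_exists: "\<exists>a. norm a = 1 \<and> a \<bullet> n = 0" for n :: R3
proof -
  obtain y where "y \<noteq> 0" "orthogonal n y"
    using orthogonal_to_vector_exists[of n] by auto
  then show ?thesis
    by (intro exI[of _ "y /\<^sub>R norm y"]) (simp add: orthogonal_def inner_commute)
qed

text \<open>
  The parametrisation of the plane is an isometry onto it, so bounded sets have bounded preimages
  and relatively open sets have open ones.
\<close>

lemma plane_measure_full_cell:
  assumes n: "norm n = 1" and "bounded S" and ne: "S \<noteq> {}"
    and W: "open W" "S = {x. n \<bullet> (x - p) = 0} \<inter> W"
  shows "full_cell (plane_measure p n) S"
proof -
  define a where "a = (SOME a. norm a = 1 \<and> a \<bullet> n = 0)"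
  have a: "norm a = 1" "a \<bullet> n = 0"
    using someI_ex[OF orthonormal_vector_exists[of n]] by (auto simp: a_def)
  define \<phi> where "\<phi> = (\<lambda>(s, t). p + s *\<^sub>R a + t *\<^sub>R cross3 n a)"
  have pm: "plane_measure p n = distr lborel borel \<phi>"
    by (simp add: plane_measure_def Let_def a_def \<phi>_def)
  have cont: "continuous_on UNIV \<phi>"
    unfolding \<phi>_def by (auto simp: case_prod_unfold intro!: continuous_intros)
  then have m: "\<phi> \<in> lborel \<rightarrow>\<^sub>M borel" by (simp add: borel_measurable_continuous_onI)
  have nn: "n \<bullet> n = 1" "a \<bullet> a = 1" using n a by (simp_all add: norm_eq_1)
  have m1: "cross3 n a \<bullet> cross3 n a = 1" "a \<bullet> cross3 n a = 0" "n \<bullet> cross3 n a = 0"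
    using nn a(2) by (simp_all add: dot_cross dot_cross_self inner_commute)
  have norm\<phi>: "norm z = norm (\<phi> z - p)" for z
    using nn m1 by (cases z) (simp add: \<phi>_def norm_eq norm_Pair inner_add_left inner_add_right
        norm_eq_sqrt_inner inner_commute power2_eq_square)
  have plane: "n \<bullet> (\<phi> z - p) = 0" for z
    using m1 a by (cases z) (simp add: \<phi>_def inner_add_right inner_commute)
  have surj: "\<exists>z. x = \<phi> z" if "n \<bullet> (x - p) = 0" for x
    using cross_frame_expansion[OF n a that]
    by (intro exI[of _ "((x - p) \<bullet> a, (x - p) \<bullet> cross3 n a)"]) (simp add: \<phi>_def algebra_simps)
  have pre: "\<phi> -` (S \<inter> V) = \<phi> -` (W \<inter> V)" for V using plane by (auto simp: W(2))
  have opn: "open (\<phi> -` (W \<inter> V))" if "open V" for V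
    using cont that W(1) by (intro open_vimage open_Int)
  obtain C where C: "\<And>x. x \<in> S \<Longrightarrow> norm x \<le> C" using assms(2) by (auto simp: bounded_iff)
  have "norm z \<le> norm p + C" if "\<phi> z \<in> S" for z
  proof -
    have "norm (\<phi> z - p) \<le> norm (\<phi> z) + norm p" by (rule norm_triangle_ineq4)
    then show ?thesis using C[OF that] norm\<phi>[of z] by linarith
  qed
  then have bdd: "bounded (\<phi> -` S)" unfolding bounded_iff by (intro exI[of _ "norm p + C"]) blast
  have "closed {x. n \<bullet> (x - p) = 0}"
    by (intro closed_Collect_eq continuous_intros)
  then have S: "S \<in> sets borel" using W by auto
  show ?thesis
    unfolding full_cell_def full_cell_axioms_def bounded_cell_def
  proof (intro conjI allI impI)
    show "emeasure (plane_measure p n) S < \<infinity>"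
      using emeasure_bounded_finite[OF bdd] S by (simp add: pm emeasure_distr[OF m])
    fix x V assume x: "x \<in> S" "open V" "x \<in> V"
    have "n \<bullet> (x - p) = 0" using x(1) W(2) by auto
    then obtain z where z: "x = \<phi> z" using surj by blast
    have "z \<in> \<phi> -` (W \<inter> V)" using x z W(2) by auto
    then have "emeasure lborel (\<phi> -` (W \<inter> V)) > 0"
      using emeasure_lborel_open_pos[OF opn[OF x(2)]] by blast
    moreover have "emeasure (plane_measure p n) (S \<inter> V) = emeasure lborel (\<phi> -` (S \<inter> V))"
      unfolding pm by (subst emeasure_distr[OF m]) (use S x(2) in auto)
    ultimately show "emeasure (plane_measure p n) (S \<inter> V) > 0" by (simp only: pre)
  qed (use S ne assms(2) in \<open>simp_all add: pm\<close>)
qed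

lemma polyhedral_bounded: "polyhedral S \<Longrightarrow> bounded S"
  by (auto simp: polyhedral_def intro: polytope_imp_bounded)

lemma polyhedral_cell_bounded: "polyhedral_cell k S \<Longrightarrow> bounded S"
  unfolding polyhedral_cell_def using polyhedral_bounded bounded_subset closure_subset by blast

text \<open>
  A small multiple of \<open>u\<close> is a difference of two points of the relatively open set. The case
  \<open>n = 0\<close> covers open subsets of the whole space.
\<close>

lemma relatively_open_tangent_space:
  assumes x: "x \<in> S" and S: "S = {y. n \<bullet> (y - p) = 0} \<inter> W" and W: "open W" and u: "n \<bullet> u = 0"
  shows "u \<in> tangent_space S"
proof (cases "u = 0")
  case True then show ?thesis using subspace_tangent_space subspace_0 by blast
next
  case False
  obtain e where e: "e > 0" "ball x e \<subseteq> W" using x S W open_contains_ball by blast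
  define s where "s = e / (2 * norm u)"
  have s: "s > 0" "norm (s *\<^sub>R u) < e" using e False by (simp_all add: s_def)
  have "x + s *\<^sub>R u \<in> W" using e s by (auto simp: dist_norm)
  then have "x + s *\<^sub>R u \<in> S" using x u by (simp add: S inner_diff_right inner_add_right)
  then have "(x + s *\<^sub>R u) - x \<in> tangent_space S" using x by (rule diff_in_tangent_space)
  then have "(1 / s) *\<^sub>R (s *\<^sub>R u) \<in> tangent_space S"
    using subspace_scale[OF subspace_tangent_space, of "s *\<^sub>R u" S "1 / s"]
    by (simp only: add_diff_cancel_left')
  moreover have "(1 / s) *\<^sub>R (s *\<^sub>R u) = u" using s(1) by simp
  ultimately show ?thesis by simp
qed

lemma element_cell:
  assumes "polyhedral_cell 3 T"
  shows "open T" "bounded T" "full_cell lborel T" "tangent_space T = UNIV"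
proof -
  have "affine hull T = UNIV"
    using assms aff_dim_eq_full[of T] by (simp add: polyhedral_cell_def)
  then show T: "open T" using assms by (simp add: polyhedral_cell_def open_openin[symmetric])
  show "bounded T" using assms by (rule polyhedral_cell_bounded)
  then show "full_cell lborel T" using T assms by (intro full_cell_lborel) (auto simp: polyhedral_cell_def)
  obtain x where "x \<in> T" using assms by (auto simp: polyhedral_cell_def)
  then show "tangent_space T = UNIV"
    using relatively_open_tangent_space[of x T 0 0 T] T by auto
qed

text \<open>
  The affine hull of a face is the whole plane with the given normal, by equality of dimensions;
  hence relative openness of the face is openness in that plane.
\<close>

lemma face_cell:
  assumes F: "polyhedral_cell 2 F" and n: "norm n = 1" "\<And>\<xi>. \<xi> \<in> tangent_space F \<Longrightarrow> n \<bullet> \<xi> = 0"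
    and p: "p \<in> closure F"
  shows "full_cell (plane_measure p n) F" "tangent_space F = {\<xi>. n \<bullet> \<xi> = 0}"
proof -
  obtain x where x: "x \<in> F" using F by (auto simp: polyhedral_cell_def)
  let ?P = "{y. n \<bullet> y = n \<bullet> x}"
  have F_P: "F \<subseteq> ?P"
    using n(2)[OF diff_in_tangent_space[OF _ x]] by (auto simp: inner_diff_right)
  have "closed ?P" by (rule closed_hyperplane)
  then have "p \<in> ?P" using closure_minimal[OF F_P] p by blast
  then have P: "?P = {y. n \<bullet> (y - p) = 0}" by (auto simp: inner_diff_right)
  have aff: "affine hull F = ?P"
  proof (rule affine_dim_equal)
    show "affine hull F \<subseteq> ?P" using F_P affine_hyperplane by (rule hull_minimal)
    show "affine hull F \<noteq> {}" using x by auto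
    show "affine ?P" by (rule affine_hyperplane)
    have "n \<noteq> 0" using n(1) by auto
    then show "aff_dim (affine hull F) = aff_dim ?P"
      using F by (simp add: polyhedral_cell_def aff_dim_hyperplane aff_dim_affine_hull)
  qed (rule affine_affine_hull)
  then obtain W where W: "open W" "F = ?P \<inter> W"
    using F by (auto simp: polyhedral_cell_def openin_open)
  show "full_cell (plane_measure p n) F"
    using W x by (intro plane_measure_full_cell[OF n(1) polyhedral_cell_bounded[OF F] _ W(1)]) (auto simp: P)
  show "tangent_space F = {\<xi>. n \<bullet> \<xi> = 0}"
    using n(2) relatively_open_tangent_space[OF x _ W(1)] W(2) P by blast
qed

section \<open>Derivatives of the test functions\<close>

lemma grad_affine: "grad (\<lambda>x. a \<bullet> x - c) y = a"
  unfolding grad_def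
proof (rule the_equality)
  have D: "GDERIV (\<lambda>x. a \<bullet> x - c) y :> a"
    unfolding gderiv_def by (auto intro!: derivative_eq_intros simp: inner_commute)
  then show "GDERIV (\<lambda>x. a \<bullet> x - c) y :> a" .
  fix d assume "GDERIV (\<lambda>x. a \<bullet> x - c) y :> d"
  then have "(\<lambda>h. h \<bullet> d) = (\<lambda>h. h \<bullet> a)"
    using D unfolding gderiv_def by (rule has_derivative_unique)
  then have "(d - a) \<bullet> d = (d - a) \<bullet> a" by metis
  then have "(d - a) \<bullet> (d - a) = 0" by (simp add: inner_diff_right)
  then show "d = a" by simp
qed

lemma curl_cross: "curl (\<lambda>x. cross3 (x - p) \<xi>) y = - 2 *\<^sub>R \<xi>"
proof -
  have "((\<lambda>x. cross3 (x - p) \<xi>) has_derivative (\<lambda>h. cross3 h \<xi>)) (at y)"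
  proof -
    have "bounded_linear (\<lambda>h. cross3 h \<xi>)"
      using linear_cross_left by (simp add: linear_conv_bounded_linear)
    then have "((\<lambda>x. cross3 (x - p) \<xi>) has_derivative (\<lambda>h. cross3 (h - 0) \<xi>)) (at y)"
      by (rule bounded_linear.has_derivative) (intro derivative_intros)
    then show ?thesis by simp
  qed
  then have D: "frechet_derivative (\<lambda>x. cross3 (x - p) \<xi>) (at y) = (\<lambda>h. cross3 h \<xi>)"
    by (rule frechet_derivative_at[symmetric])
  show ?thesis
    by (simp add: curl_def jac_def D vec_eq_iff forall_3 vector_3 cross_components axis_def)
qed

lemma radial_derivative:
  "frechet_derivative (\<lambda>x. (a \<bullet> x + b) *\<^sub>R (x - p)) (at y) =
    (\<lambda>h. (a \<bullet> h) *\<^sub>R (y - p) + (a \<bullet> y + b) *\<^sub>R h)" for a b p y :: _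
  by (rule frechet_derivative_at[symmetric])
    (auto intro!: derivative_eq_intros simp: algebra_simps)

lemma dvg_radial:
  "dvg (\<lambda>x. (a \<bullet> x + b) *\<^sub>R (x - p)) y = 3 * (a \<bullet> y + b) + a \<bullet> (y - p)"
proof -
  have "dvg (\<lambda>x. (a \<bullet> x + b) *\<^sub>R (x - p)) y = (\<Sum>i\<in>UNIV. a $ i * (y - p) $ i + (a \<bullet> y + b))"
    unfolding dvg_def jac_def radial_derivative
    by (intro sum.cong refl) (simp add: inner_axis axis_nth)
  then show ?thesis by (simp add: sum.distrib inner_vec_def)
qed

lemma div_F_radial:
  assumes "norm n = 1" "n \<bullet> a = 0"
  shows "div_F n (\<lambda>x. (a \<bullet> x + b) *\<^sub>R (x - p)) y = 2 * (a \<bullet> y + b) + a \<bullet> (y - p)"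
  using assms by (simp add: div_F_def dvg_radial radial_derivative inner_commute[of a n] norm_eq_1)

lemma linear_inner_cross_right: "linear (\<lambda>\<xi>. v \<bullet> cross3 u \<xi>)"
  and linear_inner_cross_left: "linear (\<lambda>\<xi>. v \<bullet> cross3 \<xi> u)"
  by (auto intro!: linearI simp: cross_add_right cross_add_left cross_mult_right cross_mult_left
      inner_add_right)

lemma linear_inner_cross_cross: "linear (\<lambda>\<xi>. v \<bullet> cross3 (cross3 u \<xi>) n)"
  by (auto intro!: linearI simp: cross_add_right cross_add_left cross_mult_right cross_mult_left
      inner_add_right)

lemma (in bounded_cell) linear_integral_affine:
  assumes "continuous_on (closure S) h"
  shows "linear (\<lambda>u. LINT x:S|\<nu>. h x * (fst u \<bullet> x + snd u))"
  by (rule linear_integral)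
    (auto intro!: continuous_intros assms linearI simp: algebra_simps inner_add_left)

lemma continuous_on_poly1: "g \<in> poly1 P \<Longrightarrow> continuous_on X g"
  by (auto simp: poly1_def intro!: continuous_intros)

lemma ball_poly1: "(\<forall>p\<in>poly1 P. \<Phi> p) \<longleftrightarrow> (\<forall>a\<in>tangent_space P. \<forall>b. \<Phi> (\<lambda>x. a \<bullet> x + b))"
  by (auto simp: poly1_def)

section \<open>The discrete operators\<close>

locale poly_mesh =
  fixes M :: mesh
  assumes mesh: "polyhedral_mesh M"
begin

lemma elem_facesD: "F \<in> elem_faces M T \<Longrightarrow> F \<in> faces M"
  and face_edgesD: "E \<in> face_edges M F \<Longrightarrow> E \<in> edges M"
  by (auto simp: elem_faces_def face_edges_def)

context
  fixes T assumes T: "T \<in> elems M"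
begin

lemma elem_polyhedral_cell: "polyhedral_cell 3 T"
  using mesh T by (auto simp: polyhedral_mesh_def)

lemmas elem_open = element_cell(1)[OF elem_polyhedral_cell]
lemmas elem_full_cell = element_cell(3)[OF elem_polyhedral_cell]
lemmas elem_tangent_space = element_cell(4)[OF elem_polyhedral_cell]

end

context
  fixes F assumes F: "F \<in> faces M"
begin

lemma face_normal: "norm (nrm M F) = 1" "\<And>\<xi>. \<xi> \<in> tangent_space F \<Longrightarrow> nrm M F \<bullet> \<xi> = 0"
  using mesh F by (auto simp: polyhedral_mesh_def)

lemma face_geometry:
  "full_cell (face_measure M F) F" "tangent_space F = {\<xi>. nrm M F \<bullet> \<xi> = 0}"
proof -
  have "polyhedral_cell 2 F" "pnt M F \<in> closure F"
    using mesh F by (auto simp: polyhedral_mesh_def)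
  from face_cell[OF this(1) face_normal this(2)]
  show "full_cell (face_measure M F) F" "tangent_space F = {\<xi>. nrm M F \<bullet> \<xi> = 0}"
    by (simp_all add: face_measure_def)
qed

lemmas face_full_cell = face_geometry(1)
lemmas face_bounded_cell = full_cell.axioms(1)[OF face_geometry(1)]
lemmas face_tangent_space = face_geometry(2)

end

lemma edge_bounded_cell:
  assumes E: "E \<in> edges M"
  shows "bounded_cell (edge_measure M E) E"
proof -
  have "\<forall>E\<in>edges M. \<exists>a\<in>verts M. \<exists>b\<in>verts M. a \<noteq> b \<and> E = open_segment a b"
    using mesh by (simp add: polyhedral_mesh_def)
  then obtain a b where "E = open_segment a b" using E by blast
  then have "bounded E" "E \<in> sets borel"
    using compact_imp_bounded[OF compact_segment, of a b]
    by (auto simp: open_segment_def intro: bounded_subset)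
  moreover have "norm (tgt M E) = 1" using mesh E by (auto simp: polyhedral_mesh_def)
  ultimately show ?thesis unfolding edge_measure_def by (intro line_measure_bounded_cell)
qed

lemma linear_op_C_h: "linear_op (\<lambda>v. C_h M v F)"
  unfolding C_h_def by (intro linear_op_intros)

text \<open>
  On the tangent plane, \<open>rot\<close> of an affine function is its gradient rotated by a right angle, and
  \<open>\<xi> \<mapsto> n \<times> \<xi>\<close> undoes the rotation. So the test functions can be indexed by the value \<open>\<xi>\<close> of their
  \<open>rot\<close>, which ranges over the whole plane.
\<close>

lemma linear_op_gamma_t:
  assumes F: "F \<in> faces M"
  shows "linear_op (gamma_t M F)"
proof -
  interpret full_cell "face_measure M F" F using F by (rule face_full_cell)
  let ?n = "nrm M F" and ?H = "tangent_space F"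
  define r where "r = (\<lambda>a x. a \<bullet> x - (LINT y:F|face_measure M F. a \<bullet> y) / measure (face_measure M F) F)"
  define R where "R v s = (1 / area M F) * int_face M F (\<lambda>x. C_h M v F * s x) + (1 / area M F) *
    (\<Sum>E\<in>face_edges M F. omega_FE M F E * int_edge M E (\<lambda>x. v E * s x))" for v s
  have nn: "?n \<bullet> ?n = 1" using face_normal(1)[OF F] by (simp add: norm_eq_1)
  have H: "a \<in> ?H \<longleftrightarrow> ?n \<bullet> a = 0" for a using face_tangent_space[OF F] by simp
  have P: "poly01_face M F = r ` ?H"
    using mean_zero_poly1 by (simp add: poly01_face_def int_face_def r_def)
  have rot: "rot_F ?n (r a) (pnt M F) = cross3 a ?n" if "a \<in> ?H" for a
    using that nn by (simp add: rot_F_def grad_F_def r_def grad_affine tang_def Lagrange H)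
  have turn: "cross3 (cross3 ?n \<xi>) ?n = \<xi>" if "\<xi> \<in> ?H" for \<xi>
    using that nn Lagrange[of ?n \<xi> ?n] cross_skew[of "cross3 ?n \<xi>" ?n] cross_skew[of \<xi> ?n]
    by (simp add: H)
  have turn': "cross3 ?n (cross3 a ?n) = a" if "a \<in> ?H" for a
    using that nn by (simp add: Lagrange H)
  have in_H: "cross3 ?n \<xi> \<in> ?H" "cross3 \<xi> ?n \<in> ?H" for \<xi> by (simp_all add: H dot_cross_self)
  have eq: "gamma_t M F = (\<lambda>v. THE g. g \<in> ?H \<and> (\<forall>\<xi>\<in>?H. g \<bullet> \<xi> = R v (r (cross3 ?n \<xi>))))"
  proof
    fix v
    have "(\<forall>s\<in>poly01_face M F. g \<bullet> rot_F ?n s (pnt M F) = R v s) \<longleftrightarrow>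
        (\<forall>\<xi>\<in>?H. g \<bullet> \<xi> = R v (r (cross3 ?n \<xi>)))" (is "?L \<longleftrightarrow> ?R") for g
    proof
      assume L: ?L
      show ?R
      proof
        fix \<xi> assume \<xi>: "\<xi> \<in> ?H"
        have "r (cross3 ?n \<xi>) \<in> poly01_face M F" using in_H P by blast
        then have "g \<bullet> rot_F ?n (r (cross3 ?n \<xi>)) (pnt M F) = R v (r (cross3 ?n \<xi>))" using L by blast
        then show "g \<bullet> \<xi> = R v (r (cross3 ?n \<xi>))" by (simp add: rot in_H turn[OF \<xi>])
      qed
    next
      assume ?R
      then have "g \<bullet> cross3 a ?n = R v (r a)" if "a \<in> ?H" for a
        using in_H(2)[of a] turn'[OF that] by metis
      then show ?L by (auto simp: P rot)
    qed
    then show "gamma_t M F v = (THE g. g \<in> ?H \<and> (\<forall>\<xi>\<in>?H. g \<bullet> \<xi> = R v (r (cross3 ?n \<xi>))))"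
      by (simp add: gamma_t_def R_def)
  qed
  have lr: "linear (\<lambda>\<xi>. r (cross3 ?n \<xi>) x)" for x
  proof -
    have "linear (\<lambda>a. r a x)"
      unfolding r_def
      by (intro linear_compose_sub linear_mean bounded_linear.linear[OF bounded_linear_inner_left])
    from linear_compose[OF linear_cross_right this] show ?thesis by (simp add: o_def)
  qed
  have cr: "continuous_on X (r a)" for a X unfolding r_def by (intro continuous_intros)
  show ?thesis
    unfolding eq
  proof (rule linear_op_representing_vector[OF subspace_tangent_space])
    show "linear (\<lambda>\<xi>. R v (r (cross3 ?n \<xi>)))" for v
      unfolding R_def int_face_def int_edge_def set_integral_mult_right
      by (intro linear_compose_add linear_compose_sum ballI linear_scaled_functional
          linear_integral bounded_cell.linear_integral[OF edge_bounded_cell] lr cr face_edgesD)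
    show "linear_op (\<lambda>v. R v (r (cross3 ?n \<xi>)))" for \<xi>
      unfolding R_def int_face_def int_edge_def set_integral_mult_right
      by (intro linear_op_intros linear_op_C_h)
  qed
qed

lemma linear_op_C_T: "linear_op (C_T M T)"
proof -
  have eq: "C_T M T = (\<lambda>v. THE g. g \<in> UNIV \<and> (\<forall>\<xi>\<in>UNIV. g \<bullet> \<xi> =
      (1 / vol T) * (\<Sum>F\<in>elem_faces M T. omega_TF M T F * area M F *
         (gamma_t M F v \<bullet> cross3 \<xi> (nrm M F)))))"
    by (simp add: fun_eq_iff C_T_def)
  show ?thesis
    unfolding eq
  proof (rule linear_op_representing_vector[OF subspace_UNIV])
    show "linear (\<lambda>\<xi>. (1 / vol T) * (\<Sum>F\<in>elem_faces M T. omega_TF M T F * area M F *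
         (gamma_t M F v \<bullet> cross3 \<xi> (nrm M F))))" for v
      by (intro linear_scaled_functional
          linear_compose_sum ballI linear_inner_cross_left)
    show "linear_op (\<lambda>v. (1 / vol T) * (\<Sum>F\<in>elem_faces M T. omega_TF M T F * area M F *
         (gamma_t M F v \<bullet> cross3 \<xi> (nrm M F))))" for \<xi>
      by (intro linear_op_intros linear_op_gamma_t elem_facesD)
  qed
qed

text \<open>The curl of \<open>(x - x\<^sub>T) \<times> \<xi>\<close> is \<open>- 2 \<xi>\<close>, so the defining equations prescribe all components.\<close>

lemma linear_op_P_curl:
  assumes T: "T \<in> elems M"
  shows "linear_op (P_curl M T)"
proof -
  interpret full_cell lborel T using T by (rule elem_full_cell)
  let ?w = "\<lambda>\<xi> x. cross3 (x - pnt M T) \<xi>"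
  define R where "R v \<xi> = (1 / vol T) * int_vol T (\<lambda>x. C_T M T v \<bullet> ?w \<xi> x) - (1 / vol T) *
    (\<Sum>F\<in>elem_faces M T. omega_TF M T F *
      int_face M F (\<lambda>x. gamma_t M F v \<bullet> cross3 (?w \<xi> x) (nrm M F)))" for v \<xi>
  have "g \<bullet> (- 2 *\<^sub>R \<xi>) = R v \<xi> \<longleftrightarrow> g \<bullet> \<xi> = (- 1 / 2) * R v \<xi>" for g v \<xi>
    by (auto simp: field_simps)
  then have eq: "P_curl M T = (\<lambda>v. THE g. g \<in> UNIV \<and> (\<forall>\<xi>\<in>UNIV. g \<bullet> \<xi> = (- 1 / 2) * R v \<xi>))"
    unfolding fun_eq_iff P_curl_def Let_def curl_cross by (simp add: R_def)
  show ?thesis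
    unfolding eq
  proof (rule linear_op_representing_vector[OF subspace_UNIV])
    show "linear (\<lambda>\<xi>. (- 1 / 2) * R v \<xi>)" for v
      unfolding R_def int_vol_def int_face_def
      by (intro linear_scaled_functional
          linear_compose_sub linear_compose_sum ballI linear_integral
          bounded_cell.linear_integral[OF face_bounded_cell[OF elem_facesD]]
          linear_inner_cross_right linear_inner_cross_cross continuous_intros)
    show "linear_op (\<lambda>v. (- 1 / 2) * R v \<xi>)" for \<xi>
      unfolding R_def int_vol_def int_face_def
      by (intro linear_op_mult linear_op_diff linear_op_sum linear_op_integral
          bounded_cell.linear_op_integral[OF face_bounded_cell[OF elem_facesD]]
          linear_op_inner_left linear_op_C_T linear_op_gamma_t elem_facesD continuous_intros)
  qed
qed

lemma linear_op_P_div: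
  assumes T: "T \<in> elems M"
  shows "linear_op (P_div M T)"
proof -
  interpret full_cell lborel T using T by (rule elem_full_cell)
  define r where "r = (\<lambda>a x. a \<bullet> x - (LINT y:T|lborel. a \<bullet> y) / measure lborel T)"
  define R where "R w s = - (1 / vol T) * int_vol T (\<lambda>x. D_T M T w * s x) + (1 / vol T) *
    (\<Sum>F\<in>elem_faces M T. omega_TF M T F * int_face M F (\<lambda>x. w F * s x))" for w s
  have P: "poly01_elem T = range r"
    using mean_zero_poly1 elem_tangent_space[OF T] by (simp add: poly01_elem_def int_vol_def r_def)
  have g: "grad (r a) (pnt M T) = a" for a by (simp add: r_def grad_affine)
  have eq: "P_div M T = (\<lambda>w. THE g. g \<in> UNIV \<and> (\<forall>a\<in>UNIV. g \<bullet> a = R w (r a)))"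
    by (simp add: fun_eq_iff P_div_def R_def P g)
  have lr: "linear (\<lambda>a. r a x)" for x
    unfolding r_def
    by (intro linear_compose_sub linear_mean bounded_linear.linear[OF bounded_linear_inner_left])
  have cr: "continuous_on X (r a)" for a X unfolding r_def by (intro continuous_intros)
  show ?thesis
    unfolding eq
  proof (rule linear_op_representing_vector[OF subspace_UNIV])
    show "linear (\<lambda>a. R w (r a))" for w
      unfolding R_def int_face_def int_vol_def set_integral_mult_right
      by (intro linear_compose_add linear_compose_sum ballI linear_scaled_functional
          linear_integral bounded_cell.linear_integral[OF face_bounded_cell[OF elem_facesD]] lr cr)
    show "linear_op (\<lambda>w. R w (r a))" for a
      unfolding R_def int_face_def int_vol_def set_integral_mult_right D_T_def
      by (intro linear_op_intros)
  qed
qed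

text \<open>
  Continuity of \<open>q\<close> on the skeleton makes the edge integrals linear in the test function, which is
  the hypothesis of well-posedness.
\<close>

lemma gamma_F_poly1:
  assumes F: "F \<in> faces M" and q: "q \<in> X_grad M"
  shows "gamma_F M F q \<in> poly1 F"
proof -
  interpret full_cell "face_measure M F" F using F by (rule face_full_cell)
  define l where "l p = - int_face M F (\<lambda>x. G_F M F q \<bullet> (p x *\<^sub>R (x - pnt M F))) +
      (\<Sum>E\<in>face_edges M F. omega_FE M F E *
         int_edge M E (\<lambda>x. q x * ((p x *\<^sub>R (x - pnt M F)) \<bullet> nrm_FE M F E)))" for p :: "R3 \<Rightarrow> real"
  have l_eq: "l p = - (LINT x:F|face_measure M F. (G_F M F q \<bullet> (x - pnt M F)) * p x) +
      (\<Sum>E\<in>face_edges M F. omega_FE M F E *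
         (LINT x:E|edge_measure M E. (q x * ((x - pnt M F) \<bullet> nrm_FE M F E)) * p x))" for p
    by (simp add: l_def int_face_def int_edge_def mult_ac)
  have cq: "continuous_on (closure E) q" if "E \<in> face_edges M F" for E
    using q face_edgesD[OF that] by (auto simp: X_grad_def skeleton_def intro: continuous_on_subset)
  have lin: "linear (\<lambda>(a, b). l (\<lambda>x. a \<bullet> x + b))"
    unfolding l_eq case_prod_unfold
    by (intro linear_compose_add linear_compose_neg linear_compose_sum ballI
        linear_scaled_functional
        linear_integral_affine bounded_cell.linear_integral_affine[OF edge_bounded_cell[OF face_edgesD]]
        continuous_intros cq)
  have "gamma_F M F q = (THE g. g \<in> poly1 F \<and> (\<forall>a\<in>tangent_space F. \<forall>b.
      (LINT x:F|face_measure M F. g x * (2 * (a \<bullet> x + b) + a \<bullet> (x - pnt M F))) = l (\<lambda>x. a \<bullet> x + b)))"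
    unfolding gamma_F_def Let_def ball_poly1 l_def[symmetric]
    by (simp add: int_face_def div_F_radial face_normal[OF F] cong: ball_cong)
  then show ?thesis using theI'[OF ex1_poly1[OF _ lin, of 2 "pnt M F"]] by simp
qed

lemma P_grad_poly1:
  assumes T: "T \<in> elems M" and q: "q \<in> X_grad M"
  shows "P_grad M T q \<in> poly1 T"
proof -
  interpret full_cell lborel T using T by (rule elem_full_cell)
  define l where "l p = - int_vol T (\<lambda>x. G_T M T q \<bullet> (p x *\<^sub>R (x - pnt M T))) +
      (\<Sum>F\<in>elem_faces M T. omega_TF M T F *
         int_face M F (\<lambda>x. gamma_F M F q x * ((p x *\<^sub>R (x - pnt M T)) \<bullet> nrm M F)))" for p :: "R3 \<Rightarrow> real"
  have l_eq: "l p = - (LINT x:T|lborel. (G_T M T q \<bullet> (x - pnt M T)) * p x) +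
      (\<Sum>F\<in>elem_faces M T. omega_TF M T F *
         (LINT x:F|face_measure M F. (gamma_F M F q x * ((x - pnt M T) \<bullet> nrm M F)) * p x))" for p
    by (simp add: l_def int_face_def int_vol_def mult_ac)
  have lin: "linear (\<lambda>(a, b). l (\<lambda>x. a \<bullet> x + b))"
    unfolding l_eq case_prod_unfold
    by (intro linear_compose_add linear_compose_neg linear_compose_sum ballI
        linear_scaled_functional
        linear_integral_affine bounded_cell.linear_integral_affine[OF face_bounded_cell[OF elem_facesD]]
        continuous_intros continuous_on_poly1[OF gamma_F_poly1[OF elem_facesD q]])
  have "P_grad M T q = (THE g. g \<in> poly1 T \<and> (\<forall>a\<in>tangent_space T. \<forall>b.
      (LINT x:T|lborel. g x * (3 * (a \<bullet> x + b) + a \<bullet> (x - pnt M T))) = l (\<lambda>x. a \<bullet> x + b)))"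
    unfolding P_grad_def Let_def ball_poly1 l_def[symmetric]
    by (simp add: int_vol_def dvg_radial)
  then show ?thesis using theI'[OF ex1_poly1[OF _ lin, of 3 "pnt M T"]] by simp
qed

end

section \<open>Discrete products with values in the Lie algebra\<close>

lemma coord_lincomb:
  assumes "finite_basis B"
  shows "coord B b (\<lambda>x. a *\<^sub>R v x + c *\<^sub>R w x) = (\<lambda>x. a *\<^sub>R coord B b v x + c *\<^sub>R coord B b w x)"
  using assms by (simp add: coord_def finite_basis_def representation_add representation_scale)

lemma linear_op_coord: "finite_basis B \<Longrightarrow> linear_op L \<Longrightarrow> linear_op (\<lambda>v. L (coord B b v))"
  by (simp add: linear_op_def coord_lincomb del: real_scaleR_def)

lemma linear_op_ext: "finite_basis B \<Longrightarrow> linear_op (\<lambda>v. L v y) \<Longrightarrow> linear_op (\<lambda>v. ext B L v y)"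
  unfolding ext_def by (intro linear_op_sum linear_op_scaleR_left) (rule linear_op_coord)

lemma linear_op_ext_vec:
  assumes "finite_basis B" "linear_op L"
  shows "linear_op (\<lambda>v. ext_vec B L v)"
proof -
  have "linear_op (\<lambda>v. ext_vec B L v $ i)" for i
  proof -
    have "linear_op (\<lambda>v. L v $ i)"
      using linear_op_linear[OF bounded_linear.linear[OF bounded_linear_vec_nth] assms(2)] .
    then show ?thesis
      unfolding ext_vec_def vec_lambda_beta
      by (intro linear_op_sum linear_op_scaleR_left) (rule linear_op_coord[OF assms(1)])
  qed
  then show ?thesis by (simp add: linear_op_def vec_eq_iff)
qed

text \<open>
  The last condition concerns the extension of the scalar form by the Gram matrix of \<open>B\<close>. It is
  built into the notion because it is stable under sums and immediate for squares of linear
  functionals, and both discrete products are sums of such squares.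
\<close>

definition psd_form :: "'g::real_inner set \<Rightarrow> (('x \<Rightarrow> real) \<Rightarrow> ('x \<Rightarrow> real) \<Rightarrow> real) \<Rightarrow> bool" where
  "psd_form B ip \<longleftrightarrow> (\<forall>w. linear_op (\<lambda>v. ip v w)) \<and> (\<forall>v w. ip v w = ip w v) \<and>
     (\<forall>v. 0 \<le> ip_g B ip v v)"

text \<open>The extended form is \<open>c\<close> times the squared norm of \<open>\<Sum>b. f v\<^sub>b b\<close>.\<close>

lemma psd_form_square:
  fixes f :: "('x \<Rightarrow> real) \<Rightarrow> real"
  assumes "linear_op f" "0 \<le> c"
  shows "psd_form B (\<lambda>v w. c * (f v * f w))"
proof -
  have "0 \<le> ip_g B (\<lambda>v w. c * (f v * f w)) v v" for v
  proof -
    let ?s = "\<Sum>b\<in>B. f (coord B b v) *\<^sub>R b"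
    have "ip_g B (\<lambda>v w. c * (f v * f w)) v v = c * (?s \<bullet> ?s)"
      by (simp add: ip_g_def inner_sum_left inner_sum_right sum_distrib_left inner_commute mult_ac)
    then show ?thesis using assms(2) by simp
  qed
  then show ?thesis
    using linear_op_mult[OF linear_op_mult_left[OF assms(1)], of c] by (simp add: psd_form_def mult.commute)
qed

lemma psd_form_0: "psd_form B (\<lambda>v w. 0)"
  by (simp add: psd_form_def linear_op_def ip_g_def)

lemma psd_form_add:
  assumes "psd_form B ip" "psd_form B ip'"
  shows "psd_form B (\<lambda>v w. ip v w + ip' v w)"
proof -
  have "ip_g B (\<lambda>v w. ip v w + ip' v w) v v = ip_g B ip v v + ip_g B ip' v v" for v
    by (simp add: ip_g_def sum.distrib distrib_right)
  then show ?thesis using assms by (auto simp: psd_form_def intro!: linear_op_add)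
qed

lemma psd_form_sum:
  "(\<And>i. i \<in> I \<Longrightarrow> psd_form B (ip i)) \<Longrightarrow> psd_form B (\<lambda>v w. \<Sum>i\<in>I. ip i v w)"
  by (induction I rule: infinite_finite_induct) (auto simp: psd_form_0 intro!: psd_form_add)

lemma psd_form_inner:
  fixes f :: "('x \<Rightarrow> real) \<Rightarrow> R3"
  assumes f: "linear_op f" and c: "0 \<le> c"
  shows "psd_form B (\<lambda>v w. c * (f v \<bullet> f w))"
proof -
  have "linear_op (\<lambda>v. f v $ i)" for i
    using linear_op_linear[OF bounded_linear.linear[OF bounded_linear_vec_nth] f] .
  then have "psd_form B (\<lambda>v w. \<Sum>i\<in>UNIV. c * (f v $ i * f w $ i))"
    by (intro psd_form_sum psd_form_square c)
  then show ?thesis by (simp add: inner_vec_def sum_distrib_left)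
qed

lemma ip_g_sym: "psd_form B ip \<Longrightarrow> ip_g B ip v w = ip_g B ip w v"
  unfolding ip_g_def psd_form_def by (subst sum.swap) (simp add: inner_commute)

lemma linear_op_ip_g: "finite_basis B \<Longrightarrow> psd_form B ip \<Longrightarrow> linear_op (\<lambda>v. ip_g B ip v w)"
  unfolding ip_g_def psd_form_def
  by (intro linear_op_sum linear_op_mult_left) (auto intro: linear_op_coord)

lemma linear_op_ip_g_right: "finite_basis B \<Longrightarrow> psd_form B ip \<Longrightarrow> linear_op (\<lambda>w. ip_g B ip v w)"
  using linear_op_ip_g[of B ip v] ip_g_sym[of B ip v] by simp

text \<open>
  The numerical dissipation of the implicit Euler method: the difference of the two sides is the
  form evaluated at \<open>x - y\<close>.
\<close>

lemma ip_g_increment: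
  assumes B: "finite_basis B" and ip: "psd_form B ip"
  shows "ip_g B ip x x - ip_g B ip y y \<le> 2 * ip_g B ip (\<lambda>e. x e - y e) x"
proof -
  have l: "ip_g B ip (\<lambda>e. x e - y e) w = ip_g B ip x w - ip_g B ip y w" for w
    using linear_opD[OF linear_op_ip_g[OF B ip], of 1 x "-1" y w] by simp
  have "0 \<le> ip_g B ip (\<lambda>e. x e - y e) (\<lambda>e. x e - y e)" using ip by (simp add: psd_form_def)
  also have "\<dots> = ip_g B ip x x - 2 * ip_g B ip y x + ip_g B ip y y"
    unfolding l ip_g_sym[OF ip, of _ "\<lambda>e. x e - y e"] using ip_g_sym[OF ip, of x y] by simp
  finally show ?thesis by (simp add: l)
qed

section \<open>The bracket and the magnetic field\<close>

locale lie_mesh = poly_mesh M for M +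
  fixes br :: "'g::real_inner \<Rightarrow> 'g \<Rightarrow> 'g" and B :: "'g set"
  assumes bracket: "invariant_lie_bracket br" and basis: "finite_basis B"
begin

lemma linear_bracket: "linear (\<lambda>a. br a b)" "linear (br a)"
  using bracket by (auto simp: invariant_lie_bracket_def bilinear_def)

lemma bracket_self: "br a a = 0" and bracket_invariant: "br a b \<bullet> c = a \<bullet> br b c"
  using bracket by (auto simp: invariant_lie_bracket_def)

lemma bracket_skew: "br a b = - br b a"
proof -
  have "br a b + br b a = br (a + b) (a + b)"
    unfolding linear_add[OF linear_bracket(1)] linear_add[OF linear_bracket(2)]
    by (simp add: bracket_self)
  also have "\<dots> = 0" by (rule bracket_self)
  finally show ?thesis by (rule eq_neg_iff_add_eq_0[THEN iffD2])
qed

lemma inner_bracket_self: "a \<bullet> br a b = 0"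
  using bracket_invariant[of a a b] by (simp add: bracket_self)

lemma inner_bracket_vec_self: "v \<bullet> bracket_vec br v q = 0"
  by (simp add: inner_vec_def bracket_vec_def inner_bracket_self)

lemma linear_bracket_vec: "linear (\<lambda>v. bracket_vec br v q)" "linear (bracket_vec br v)"
  by (auto intro!: linearI simp: bracket_vec_def vec_eq_iff
      linear_add[OF linear_bracket(1)] linear_add[OF linear_bracket(2)]
      linear_scale[OF linear_bracket(1)] linear_scale[OF linear_bracket(2)])

text \<open>Both the Levi-Civita symbol and the bracket change sign.\<close>

lemma star_bracket_sym: "star_bracket br v w = star_bracket br w v"
proof -
  have lc: "levi_civita i j k = - levi_civita i k j" for i j k
  proof -
    have "\<forall>i j k. levi_civita i j k = - levi_civita i k j"
      unfolding forall_3 by (simp add: levi_civita_def)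
    then show ?thesis by blast
  qed
  have "(\<Sum>j\<in>UNIV. \<Sum>k\<in>UNIV. levi_civita i j k *\<^sub>R br (v $ j) (w $ k)) =
      (\<Sum>j\<in>UNIV. \<Sum>k\<in>UNIV. levi_civita i k j *\<^sub>R br (w $ k) (v $ j))" for i
    by (intro sum.cong refl) (subst bracket_skew, subst lc, simp)
  also have "\<dots> i = (\<Sum>k\<in>UNIV. \<Sum>j\<in>UNIV. levi_civita i k j *\<^sub>R br (w $ k) (v $ j))" for i
    by (rule sum.swap)
  finally show ?thesis by (simp add: star_bracket_def)
qed

lemma linear_star_bracket: "linear (\<lambda>v. star_bracket br v w)"
  by (rule linearI)
    (simp_all add: star_bracket_def vec_eq_iff linear_add[OF linear_bracket(1)]
      linear_scale[OF linear_bracket(1)] scaleR_right_distrib sum.distrib scaleR_sum_right mult.commute)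

lemma star_div_sym: "star_div M br B v w F = star_div M br B w v F"
  by (simp add: star_div_def star_bracket_sym[of "ext_vec B (gamma_t M F) v"])

lemma linear_op_star_div:
  assumes "F \<in> faces M"
  shows "linear_op (\<lambda>v. star_div M br B v w F)"
proof -
  have "linear_op (\<lambda>v. star_bracket br (ext_vec B (gamma_t M F) v) (ext_vec B (gamma_t M F) w) $ i)" for i
    by (rule linear_op_linear[OF bounded_linear.linear[OF bounded_linear_vec_nth]])
      (intro linear_op_linear[OF linear_star_bracket] linear_op_ext_vec basis linear_op_gamma_t assms)
  then show ?thesis unfolding star_div_def by (intro linear_op_intros)
qed

lemma linear_op_C_h_g: "linear_op (\<lambda>v. C_h_g M B v F)"
  unfolding C_h_g_def by (intro linear_op_ext basis linear_op_C_h)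

text \<open>
  For a symmetric bilinear \<open>S\<close>, \<open>S(A\<^sub>1 + A\<^sub>0, A\<^sub>1 - A\<^sub>0) = S(A\<^sub>1, A\<^sub>1) - S(A\<^sub>0, A\<^sub>0)\<close>. This is why the scheme
  evaluates the bracket at the midpoint in time.
\<close>

lemma magnetic_increment:
  assumes F: "F \<in> faces M" and h: "h \<noteq> 0"
    and e: "e = (\<lambda>x. (- 1 / h) *\<^sub>R A1 x + (1 / h) *\<^sub>R A0 x)"
    and A: "A = (\<lambda>x. (1 / 2) *\<^sub>R A1 x + (1 / 2) *\<^sub>R A0 x)"
  shows "C_h_g M B e F + star_div M br B A e F =
    (- 1 / h) *\<^sub>R magnetic M br B A1 F + (1 / h) *\<^sub>R magnetic M br B A0 F"
proof -
  let ?S = "\<lambda>v w. star_div M br B v w F"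
  note l = linear_opD[OF linear_op_star_div[OF F]]
  have C: "C_h_g M B e F = (- 1 / h) *\<^sub>R C_h_g M B A1 F + (1 / h) *\<^sub>R C_h_g M B A0 F"
    unfolding e by (rule linear_opD[OF linear_op_C_h_g])
  have r: "?S v e = (- 1 / h) *\<^sub>R ?S v A1 + (1 / h) *\<^sub>R ?S v A0" for v
    unfolding star_div_sym[of v] e by (rule l)
  have "?S A e = (1 / 2) *\<^sub>R ?S A1 e + (1 / 2) *\<^sub>R ?S A0 e" unfolding A by (rule l)
  also have "\<dots> = (- 1 / h) *\<^sub>R (1 / 2) *\<^sub>R ?S A1 A1 + (1 / h) *\<^sub>R (1 / 2) *\<^sub>R ?S A0 A0"
    unfolding r star_div_sym[of A0 A1]
    by (simp add: scaleR_right_distrib scaleR_right_diff_distrib mult.commute)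
  finally show ?thesis using C by (simp add: magnetic_def scaleR_right_distrib)
qed

lemma int_face_const: "int_face M F (\<lambda>x. c) = c * area M F" if "F \<in> faces M"
  using bounded_cell.S_borel[OF face_bounded_cell[OF that]]
    bounded_cell.sets_eq[OF face_bounded_cell[OF that]]
  by (simp add: int_face_def area_def set_integral_const)

lemma int_edge_const: "int_edge M E (\<lambda>x. c) = c * len M E" if "E \<in> edges M"
  using bounded_cell.S_borel[OF edge_bounded_cell[OF that]]
    bounded_cell.sets_eq[OF edge_bounded_cell[OF that]]
  by (simp add: int_edge_def len_def set_integral_const)

lemma int_vol_const: "int_vol T (\<lambda>x. c) = c * vol T" if "T \<in> elems M"
  using elem_open[OF that] by (simp add: int_vol_def vol_def set_integral_const)

lemma linear_tang: "linear (tang n)"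
  unfolding tang_def
  by (auto intro!: linearI simp: cross_add_left cross_add_right cross_mult_left cross_mult_right)

lemma elem_edgesD: "E \<in> elem_edges M T \<Longrightarrow> E \<in> edges M"
  by (simp add: elem_edges_def)

lemma face_diameter_nonneg: "F \<in> faces M \<Longrightarrow> 0 \<le> diameter F"
  by (intro diameter_ge_0 bounded_cell.S_bounded[OF face_bounded_cell])

text \<open>
  The integrands of the products are constant on each cell, so the products are finite sums of
  squares of linear functionals with nonnegative weights.
\<close>

lemma psd_form_ip_curl: "psd_form B (ip_curl M)"
proof -
  have eq: "ip_curl M = (\<lambda>v w. \<Sum>T\<in>elems M. vol T * (P_curl M T v \<bullet> P_curl M T w) +
     ((\<Sum>F\<in>elem_faces M T. (diameter F * area M F) *
        ((tang (nrm M F) (P_curl M T v) - gamma_t M F v) \<bullet>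
        (tang (nrm M F) (P_curl M T w) - gamma_t M F w))) +
     (\<Sum>E\<in>elem_edges M T. ((diameter E)\<^sup>2 * len M E) *
        ((P_curl M T v \<bullet> tgt M E - v E) * (P_curl M T w \<bullet> tgt M E - w E)))))"
    unfolding ip_curl_def[abs_def] s_curl_def
    by (intro HOL.ext sum.cong refl arg_cong2[where f="(+)"])
      (simp_all only: int_vol_const int_face_const[OF elem_facesD] int_edge_const[OF elem_edgesD] mult_ac)
  show ?thesis
    unfolding eq
    by (intro psd_form_sum psd_form_add psd_form_inner psd_form_square linear_op_P_curl
        linear_op_diff linear_op_inner_left linear_op_linear[OF linear_tang] linear_op_gamma_t
        linear_op_eval elem_facesD elem_edgesD mult_nonneg_nonneg face_diameter_nonneg zero_le_power2)
      (simp_all add: vol_def area_def len_def)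
qed

lemma psd_form_ip_div: "psd_form B (ip_div M)"
proof -
  have eq: "ip_div M = (\<lambda>v w. \<Sum>T\<in>elems M. vol T * (P_div M T v \<bullet> P_div M T w) +
     (\<Sum>F\<in>elem_faces M T. (diameter F * area M F) *
        ((P_div M T v \<bullet> nrm M F - v F) * (P_div M T w \<bullet> nrm M F - w F))))"
    unfolding ip_div_def[abs_def] s_div_def
    by (intro HOL.ext sum.cong refl arg_cong2[where f="(+)"])
      (simp_all only: int_vol_const int_face_const[OF elem_facesD] mult_ac)
  show ?thesis
    unfolding eq
    by (intro psd_form_sum psd_form_add psd_form_inner psd_form_square linear_op_P_div
        linear_op_diff linear_op_inner_left linear_op_eval elem_facesD mult_nonneg_nonneg face_diameter_nonneg)
      (simp_all add: vol_def area_def)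
qed

text \<open>
  The identity for the magnetic field is about faces of the mesh, whereas discrete fields
  are total functions of sets; the values elsewhere do not matter.
\<close>

lemma ip_div_g_cong:
  assumes "\<And>F. F \<in> faces M \<Longrightarrow> w F = w' F"
  shows "ip_div_g M B u w = ip_div_g M B u w'"
proof -
  have "ip_div M v (coord B b w) = ip_div M v (coord B b w')" for v b
  proof -
    have c: "coord B b w F = coord B b w' F" if "F \<in> elem_faces M T" for F T
      using assms[OF elem_facesD[OF that]] by (simp add: coord_def)
    have "P_div M T (coord B b w) = P_div M T (coord B b w')" for T
      unfolding P_div_def D_T_def by (simp add: c cong: sum.cong)
    then show ?thesis unfolding ip_div_def s_div_def by (simp add: c cong: sum.cong)
  qed
  then show ?thesis by (simp add: ip_div_g_def ip_g_def)
qed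

section \<open>Preservation of the constraint\<close>

definition coupling :: "(R3 \<Rightarrow> 'g) \<Rightarrow> (R3 set \<Rightarrow> 'g) \<Rightarrow> (R3 set \<Rightarrow> 'g) \<Rightarrow> R3 \<Rightarrow> real" where
  "coupling q v w x = P_curl_g M B v x \<bullet> bracket_vec br (P_curl_g M B w x) (P_grad_g M B q x)"

lemma linear_op_P_curl_g: "linear_op (\<lambda>v. P_curl_g M B v x)"
proof -
  have "linear_op (\<lambda>v. if x \<in> T then ext_vec B (P_curl M T) v else 0)" if "T \<in> elems M" for T
    using linear_op_ext_vec[OF basis linear_op_P_curl[OF that]] by (auto simp: linear_op_def)
  then show ?thesis unfolding P_curl_g_def by (rule linear_op_sum)
qed

lemma coupling_lincomb_left:
  "coupling q (\<lambda>e. a *\<^sub>R v e + b *\<^sub>R w e) u x = a * coupling q v u x + b * coupling q w u x"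
  unfolding coupling_def linear_opD[OF linear_op_P_curl_g] by (simp add: inner_add_left)

lemma coupling_lincomb_right:
  "coupling q u (\<lambda>e. a *\<^sub>R v e + b *\<^sub>R w e) x = a * coupling q u v x + b * coupling q u w x"
  unfolding coupling_def linear_opD[OF linear_op_P_curl_g]
  by (simp add: linear_add[OF linear_bracket_vec(1)] linear_scale[OF linear_bracket_vec(1)] inner_add_right)

lemma coupling_self: "coupling q v v x = 0"
  by (simp add: coupling_def inner_bracket_vec_self)

lemma region_open: "open (region M)"
  using mesh by (simp add: polyhedral_mesh_def)

text \<open>
  The coupling is a finite combination of affine functions, each restricted to an intersection of
  elements.
\<close>

lemma integrable_coupling:
  assumes q: "q \<in> X_grad_g M B"
  shows "set_integrable lborel (region M) (coupling q v w)"
proof -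
  define k where "k T' T'' b = ext_vec B (P_curl M T') v \<bullet> bracket_vec br (ext_vec B (P_curl M T'') w) b"
    for T' T'' b
  define f where "f T T' T'' b x = P_grad M T (coord B b q) x * k T' T'' b" for T T' T'' b x
  have eq: "coupling q v w x = (\<Sum>T\<in>elems M. \<Sum>b\<in>B. \<Sum>T'\<in>elems M. \<Sum>T''\<in>elems M.
      indicator (T \<inter> (T' \<inter> T'')) x * f T T' T'' b x)" for x
  proof -
    have P: "P_curl_g M B u x = (\<Sum>T\<in>elems M. indicator T x *\<^sub>R ext_vec B (P_curl M T) u)" for u
      unfolding P_curl_g_def by (intro sum.cong) auto
    have G: "P_grad_g M B q x =
        (\<Sum>T\<in>elems M. \<Sum>b\<in>B. (indicator T x * P_grad M T (coord B b q) x) *\<^sub>R b)"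
      unfolding P_grad_g_def ext_def by (intro sum.cong) auto
    have K: "P_curl_g M B v x \<bullet> bracket_vec br (P_curl_g M B w x) b =
        (\<Sum>T'\<in>elems M. \<Sum>T''\<in>elems M. indicator (T' \<inter> T'') x * k T' T'' b)" for b
      unfolding P linear_sum[OF linear_bracket_vec(1)] linear_scale[OF linear_bracket_vec(1)]
        inner_sum_left
      by (simp add: inner_sum_right k_def indicator_inter_arith sum_distrib_left mult_ac)
    show ?thesis
      unfolding coupling_def G linear_sum[OF linear_bracket_vec(2)] inner_sum_right
        linear_scale[OF linear_bracket_vec(2)] inner_scaleR_right K f_def sum_distrib_left
      by (simp add: indicator_inter_arith mult_ac)
  qed
  have 1: "set_integrable lborel (region M) (\<lambda>x. indicator (T \<inter> (T' \<inter> T'')) x * f T T' T'' b x)"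
    if T: "T \<in> elems M" "T' \<in> elems M" "T'' \<in> elems M" "b \<in> B" for T T' T'' b
  proof -
    let ?S = "region M \<inter> (T \<inter> (T' \<inter> T''))"
    have "bounded_cell lborel ?S"
      using T elem_open region_open mesh
      by (intro bounded_cell_lborel open_Int) (auto simp: polyhedral_mesh_def)
    moreover have "P_grad M T (coord B b q) \<in> poly1 T"
      using T q by (intro P_grad_poly1) (auto simp: X_grad_g_def)
    ultimately have "set_integrable lborel ?S (f T T' T'' b)"
      unfolding f_def by (intro bounded_cell.set_integrable_continuous continuous_intros continuous_on_poly1)
    then show ?thesis by (simp add: set_integrable_def indicator_inter_arith mult_ac)
  qed
  show ?thesis
    unfolding eq[abs_def] set_integrable_def scaleR_sum_right
    by (intro Bochner_Integration.integrable_sum 1[unfolded set_integrable_def])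
qed

lemma integral_coupling_lincomb:
  assumes "q \<in> X_grad_g M B"
  shows "(LINT x:region M|lborel. coupling q (\<lambda>e. a *\<^sub>R v e + b *\<^sub>R w e) u x) =
    a * (LINT x:region M|lborel. coupling q v u x) + b * (LINT x:region M|lborel. coupling q w u x)"
  unfolding coupling_lincomb_left using integrable_coupling[OF assms] by simp

lemma constraint_coupling:
  "constraint M br B A E q =
    ip_curl_g M B E (G_h_g M B q) + (LINT x:region M|lborel. coupling q E A x)"
  by (simp add: constraint_def coupling_def)

text \<open>
  Linearity in the electric field is used with the old potential \<open>A\<^sub>0\<close>; passing to \<open>A\<^sub>1\<close> is free
  because the coupling of \<open>E\<^sub>1\<close> with itself vanishes.
\<close>

lemma constraint_step:
  assumes q: "q \<in> X_grad_g M B" and h: "h \<noteq> 0"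
    and A1: "A1 = (\<lambda>e. 1 *\<^sub>R A0 e + (- h) *\<^sub>R E1 e)"
    and \<delta>: "\<delta> = (\<lambda>e. (1 / h) *\<^sub>R E1 e + (- 1 / h) *\<^sub>R E0 e)"
    and step: "constraint M br B A0 \<delta> q = 0"
  shows "constraint M br B A1 E1 q = constraint M br B A0 E0 q"
proof -
  have "coupling q E1 A1 x = coupling q E1 A0 x" for x
    unfolding A1 coupling_lincomb_right by (simp add: coupling_self)
  then have "constraint M br B A1 E1 q = constraint M br B A0 E1 q"
    by (simp add: constraint_coupling)
  moreover have "constraint M br B A0 \<delta> q =
      (1 / h) * (constraint M br B A0 E1 q - constraint M br B A0 E0 q)"
    unfolding \<delta> constraint_coupling integral_coupling_lincomb[OF q] ip_curl_g_def
      linear_opD[OF linear_op_ip_g[OF basis psd_form_ip_curl]]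
    by (simp add: algebra_simps diff_divide_distrib add_divide_distrib)
  ultimately show ?thesis using step h by simp
qed

section \<open>Energy estimate\<close>

text \<open>
  The coupling term of the evolution equation, together with the product of \<open>E\<^sub>1\<close> and the gradient of
  the multiplier, is the constraint functional at the multiplier \<open>q\<close>. Without it, only the
  increments of the two energies are left.
\<close>

lemma energy_step:
  assumes h: "h > 0"
    and E1: "E1 = (\<lambda>e. (- 1 / h) *\<^sub>R A1 e + (1 / h) *\<^sub>R A0 e)"
    and \<delta>: "\<delta> = (\<lambda>e. (1 / h) *\<^sub>R E1 e + (- 1 / h) *\<^sub>R E0 e)"
    and A: "A = (\<lambda>e. (1 / 2) *\<^sub>R A1 e + (1 / 2) *\<^sub>R A0 e)"
    and test: "ip_curl_g M B \<delta> E1 + constraint M br B A1 E1 q =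
      ip_div_g M B (magnetic M br B A1) (\<lambda>F. C_h_g M B E1 F + star_div M br B A E1 F)"
    and "constraint M br B A1 E1 q = 0"
  shows "1/2 * (norm_curl_g M B E1)\<^sup>2 + 1/2 * (norm_div_g M B (magnetic M br B A1))\<^sup>2
    \<le> 1/2 * (norm_curl_g M B E0)\<^sup>2 + 1/2 * (norm_div_g M B (magnetic M br B A0))\<^sup>2"
proof -
  let ?c = "ip_curl_g M B" and ?d = "ip_div_g M B" and ?B = "magnetic M br B"
  note c = psd_form_ip_curl and d = psd_form_ip_div
  have nn: "(norm_curl_g M B v)\<^sup>2 = ?c v v" "(norm_div_g M B w)\<^sup>2 = ?d w w" for v w
    using c d by (simp_all add: norm_curl_g_def norm_div_g_def ip_curl_g_def ip_div_g_def psd_form_def)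
  have "?d (?B A1) (\<lambda>F. C_h_g M B E1 F + star_div M br B A E1 F) =
      ?d (?B A1) (\<lambda>F. (- 1 / h) *\<^sub>R ?B A1 F + (1 / h) *\<^sub>R ?B A0 F)"
    using h by (intro ip_div_g_cong magnetic_increment E1 A) auto
  also have "\<dots> = (- 1 / h) * (?d (?B A1) (?B A1) - ?d (?B A0) (?B A1))"
    unfolding ip_div_g_def linear_opD[OF linear_op_ip_g_right[OF basis d]]
    using ip_g_sym[OF d, of "?B A0" "?B A1"] by (simp add: diff_divide_distrib)
  also have "\<dots> = (- 1 / h) * ?d (\<lambda>F. ?B A1 F - ?B A0 F) (?B A1)"
    using linear_opD[OF linear_op_ip_g[OF basis d], of 1 "?B A1" "- 1" "?B A0" "?B A1"]
    by (simp add: ip_div_g_def)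
  also have "?d (?B A1) (\<lambda>F. C_h_g M B E1 F + star_div M br B A E1 F) = ?c \<delta> E1"
    using test assms(6) by simp
  also have "?c \<delta> E1 = (1 / h) * ?c (\<lambda>e. E1 e - E0 e) E1"
    unfolding \<delta> ip_curl_g_def linear_opD[OF linear_op_ip_g[OF basis c]]
    using linear_opD[OF linear_op_ip_g[OF basis c], of 1 E1 "- 1" E0 E1]
    by (simp add: diff_divide_distrib)
  finally have "?c (\<lambda>e. E1 e - E0 e) E1 + ?d (\<lambda>F. ?B A1 F - ?B A0 F) (?B A1) = 0"
    using h by (simp add: field_simps)
  moreover have "?c E1 E1 - ?c E0 E0 \<le> 2 * ?c (\<lambda>e. E1 e - E0 e) E1"
    and "?d (?B A1) (?B A1) - ?d (?B A0) (?B A0) \<le> 2 * ?d (\<lambda>F. ?B A1 F - ?B A0 F) (?B A1)"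
    unfolding ip_curl_g_def ip_div_g_def by (intro ip_g_increment basis c d)+
  ultimately show ?thesis unfolding nn by linarith
qed

end

theorem proposition8:
  fixes M :: mesh
    and br :: "'g::real_inner \<Rightarrow> 'g \<Rightarrow> 'g" and B :: "'g set"
    and N :: nat and t :: "nat \<Rightarrow> real"
    and A E :: "nat \<Rightarrow> R3 set \<Rightarrow> 'g" and lam :: "nat \<Rightarrow> R3 \<Rightarrow> 'g"
  assumes "polyhedral_mesh M"
    and "invariant_lie_bracket br" and "finite_basis B"
    and "t 0 = 0" and "\<And>n. n < N \<Longrightarrow> t n < t (Suc n)"
    and "\<And>n. n \<le> N \<Longrightarrow> A n \<in> X_curl_g M B"
    and "\<And>n. n \<le> N \<Longrightarrow> E n \<in> X_curl_g M B"
    and "\<And>n. n \<le> N \<Longrightarrow> lam n \<in> X_grad_g M B"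
    and "constrained_scheme M br B 1 N t A E lam"
    and "\<And>q. q \<in> X_grad_g M B \<Longrightarrow> constraint M br B (A 0) (E 0) q = 0"
  shows "\<forall>n<N.
    1/2 * (norm_curl_g M B (E (Suc n)))\<^sup>2 + 1/2 * (norm_div_g M B (magnetic M br B (A (Suc n))))\<^sup>2
    \<le> 1/2 * (norm_curl_g M B (E n))\<^sup>2 + 1/2 * (norm_div_g M B (magnetic M br B (A n)))\<^sup>2"
proof -
  interpret lie_mesh M br B
    using assms(1-3) by unfold_locales
  define h where "h n = t (Suc n) - t n" for n
  have h: "h n > 0" if "n < N" for n using assms(5)[OF that] by (simp add: h_def)
  have interp: "interp Z n 1 = Z (Suc n)" "interp Z n (1 - 1) = Z n"
    "interp Z n (1 / 2) = (\<lambda>e. (1 / 2) *\<^sub>R Z (Suc n) e + (1 / 2) *\<^sub>R Z n e)"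
    for Z :: "nat \<Rightarrow> R3 set \<Rightarrow> 'g" and n
    by (simp_all add: interp_def)
  have delta: "delta_t t Z n = (\<lambda>e. (1 / h n) *\<^sub>R Z (Suc n) e + (- 1 / h n) *\<^sub>R Z n e)"
    for Z :: "nat \<Rightarrow> R3 set \<Rightarrow> 'g" and n
    by (simp add: delta_t_def h_def scaleR_right_diff_distrib)
  note scheme = assms(9)[unfolded constrained_scheme_def interp, rule_format]
  have E_A: "E (Suc n) = (\<lambda>e. (- 1 / h n) *\<^sub>R A (Suc n) e + (1 / h n) *\<^sub>R A n e)" if "n < N" for n
  proof
    fix e
    have "- E (Suc n) e = delta_t t A n e" using scheme[OF that] by metis
    then have "E (Suc n) e = - delta_t t A n e" by (metis minus_minus)
    then show "E (Suc n) e = (- 1 / h n) *\<^sub>R A (Suc n) e + (1 / h n) *\<^sub>R A n e" by (simp add: delta)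
  qed
  have A_E: "A (Suc n) = (\<lambda>e. 1 *\<^sub>R A n e + (- h n) *\<^sub>R E (Suc n) e)" if "n < N" for n
    using h[OF that] by (simp add: E_A[OF that] scaleR_right_diff_distrib scaleR_right_distrib)
  have gauss: "constraint M br B (A n) (E n) q = 0" if "n \<le> N" "q \<in> X_grad_g M B" for n q
    using that(1)
  proof (induction n)
    case 0
    show ?case using that(2) by (rule assms(10))
  next
    case (Suc n)
    then have n: "n < N" by simp
    have "constraint M br B (A n) (delta_t t E n) q = 0"
      using scheme[OF n] that(2) by (simp add: constraint_def)
    moreover have "h n \<noteq> 0" using h[OF n] by simp
    ultimately show ?case using constraint_step[OF that(2) _ A_E[OF n] delta[of E n]] Suc by simp
  qed
  show ?thesis
  proof (intro allI impI)
    fix n assume n: "n < N"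
    have lam: "lam (Suc n) \<in> X_grad_g M B" and E1: "E (Suc n) \<in> X_curl_g M B"
      using assms(7,8) n by simp_all
    have "ip_curl_g M B (G_h_g M B (lam (Suc n))) (E (Suc n)) =
        ip_curl_g M B (E (Suc n)) (G_h_g M B (lam (Suc n)))"
      unfolding ip_curl_g_def by (rule ip_g_sym[OF psd_form_ip_curl])
    then have "ip_curl_g M B (delta_t t E n) (E (Suc n)) +
        constraint M br B (A (Suc n)) (E (Suc n)) (lam (Suc n)) =
        ip_div_g M B (magnetic M br B (A (Suc n)))
          (\<lambda>F. C_h_g M B (E (Suc n)) F +
            star_div M br B (\<lambda>e. (1 / 2) *\<^sub>R A (Suc n) e + (1 / 2) *\<^sub>R A n e) (E (Suc n)) F)"
      using bspec[OF scheme[OF n, THEN conjunct2, THEN conjunct1] E1]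
      by (simp add: constraint_def inner_commute)
    from energy_step[OF h[OF n] E_A[OF n] delta[of E n] refl this gauss[OF _ lam]] n
    show "1/2 * (norm_curl_g M B (E (Suc n)))\<^sup>2 + 1/2 * (norm_div_g M B (magnetic M br B (A (Suc n))))\<^sup>2
      \<le> 1/2 * (norm_curl_g M B (E n))\<^sup>2 + 1/2 * (norm_div_g M B (magnetic M br B (A n)))\<^sup>2"
      by simp
  qed
qed

end
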